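(* Let $d,r,s$ be positive integers, let $b_0,\tilde b_0\in (l_0(\mathbb{Z}^d))^{r\times r}$ and $b_1,\dots,b_s,\tilde b_1,\dots,\tilde b_s\in (l_0(\mathbb{Z}^d))^{1\times r}$ be finitely supported matrix-valued filters, and let $\mathsf{M}_0,\dots,\mathsf{M}_s$ be $d\times d$ dilation matrices. The following statements are equivalent: (i) For every $J\in\mathbb{N}$, the $J$-level discrete framelet transform employing the filter bank $(\{b_l!\mathsf{M}_l\}_{l=0}^s,\{\tilde b_l!\mathsf{M}_l\}_{l=0}^s)$ has the perfect reconstruction property. (ii) $\tilde{\mathcal V}\mathcal W v=v$ for all $v\in (l_0(\mathbb{Z}^d))^{1\times r}$, where $\mathcal W$ is the $1$-level discrete framelet analysis operator employing $\{b_l!\mathsf{M}_l\}_{l=0}^s$ and $\tilde{\mathcal V}$ is the $1$-level discrete framelet synthesis operator employing $\{\tilde b_l!\mathsf{M}_l\}_{l=0}^s$. (iii) $(\{b_l!\mathsf{M}_l\}_{l=0}^s,\{\tilde b_l!\mathsf{M}_l\}_{l=0}^s)$ is a dual framelet filter bank with mixed dilation factors, i.e., $$\sum_{l=0}^s\chi_{\Omega_l}(\omega)\,\overline{\widehat{b_l}(\xi)}^{\mathsf T}\,\widehat{\tilde b_l}(\xi+2\pi\omega)=\boldsymbol{\delta}(\omega)I_r$$ for almost every $\xi\in\mathbb{R}^d$ and every $\omega\in\bigcup_{l=0}^s\Omega_l$, where $\Omega_l:=[\mathsf{M}_l^{-\mathsf T}\mathbb{Z}^d]\cap[0,1)^d$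 for $l=0,\dots,s$ and $\chi_E$ is the indicator function of $E\subseteq\mathbb{R}^d$.
   Context: A $d\times d$ dilation matrix is an integer matrix all of whose eigenvalues have modulus greater than $1$. $(l(\mathbb{Z}^d))^{p\times q}$ is the space of all sequences $u:\mathbb{Z}^d\to\mathbb{C}^{p\times q}$, and $(l_0(\mathbb{Z}^d))^{p\times q}$ is the subspace of finitely supported ones. For such $u$, $\widehat u(\xi):=\sum_{k\in\mathbb{Z}^d}u(k)e^{-ik\cdot\xi}$. $\overline{A}^{\mathsf T}$ is the conjugate transpose, $I_r$ the $r\times r$ identity, and $\boldsymbol\delta(0)=1$, $\boldsymbol\delta(x)=0$ for $x\ne0$. Subdivision operator: for $a\in(l_0(\mathbb{Z}^d))^{p\times q}$ and $u\in(l(\mathbb{Z}^d))^{t\times p}$, $[\mathcal S_{a,\mathsf M}u](n):=|\det(\mathsf M)|^{1/2}\sum_{k\in\mathbb{Z}^d}u(k)a(n-\mathsf Mk)$. Transition operator: for $b\in(l_0(\mathbb{Z}^d))^{p\times q}$ and $u\in(l(\mathbb{Z}^d))^{t\times q}$, $[\mathcal T_{b,\mathsf M}u](n):=|\det(\mathsf M)|^{1/2}\sum_{k\in\mathbb{Z}^d}u(k)\overline{b(k-\mathsf Mn)}^{\mathsf T}$. $J$-level discrete framelet transform: for $v\in(l(\mathbb{Z}^d))^{1\times r}$ set $v_{0,0}:=v$ and $v_{l,j}:=\mathcal T_{b_l,\mathsf M_l}v_{0,j-1}$ for $j=1,\dots,J$, $l=0,\dots,s$ (decomposition). Then set $\tilde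 v_{l,J}:=v_{l,J}$ for $l=0,\dots,s$, $\tilde v_{l,j}:=v_{l,j}$ for $l=1,\dots,s$, $j=1,\dots,J$, and recursively $\tilde v_{0,j-1}:=\sum_{l=0}^s\mathcal S_{\tilde b_l,\mathsf M_l}\tilde v_{l,j}$ for $j=J,\dots,1$ (reconstruction). The transform has the perfect reconstruction property if $\tilde v_{0,0}=v$ for every input $v\in(l(\mathbb{Z}^d))^{1\times r}$. The $1$-level operators are $\mathcal W v=(\mathcal T_{b_1,\mathsf M_1}v,\dots,\mathcal T_{b_s,\mathsf M_s}v,\mathcal T_{b_0,\mathsf M_0}v)$ and $\tilde{\mathcal V}(w_1,\dots,w_s,w_0)=\sum_{l=0}^s\mathcal S_{\tilde b_l,\mathsf M_l}w_l$, where $w_1,\dots,w_s\in l(\mathbb{Z}^d)$ and $w_0\in(l(\mathbb{Z}^d))^{1\times r}$. *)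

theory Defs
  imports "HOL-Analysis.Analysis"
begin

text \<open>
  The lattice is \<open>int ^ 'd\<close>. Following the library convention, a \<open>p \<times> q\<close> matrix has type
  \<open>complex ^ 'q ^ 'p\<close>; row vectors and scalars are the cases \<open>p = 1\<close> and \<open>p = q = 1\<close>.
\<close>

definition of_int_vec :: "int ^ 'd \<Rightarrow> real ^ 'd" where
  "of_int_vec k = (\<chi> i. of_int (k $ i))"

definition dilation_matrix :: "int ^ 'd ^ 'd \<Rightarrow> bool" where
  "dilation_matrix M \<longleftrightarrow>
     (\<forall>\<mu> :: complex. (\<exists>v. v \<noteq> 0 \<and> map_matrix of_int M *v v = \<mu> *s v) \<longrightarrow> norm \<mu> > 1)"

definition ctranspose :: "complex ^ 'q ^ 'p \<Rightarrow> complex ^ 'p ^ 'q" where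
  "ctranspose A = transpose (map_matrix cnj A)"

definition finitely_supported :: "(int ^ 'd \<Rightarrow> complex ^ 'q ^ 'p) \<Rightarrow> bool" where
  "finitely_supported u \<longleftrightarrow> finite {k. u k \<noteq> 0}"

text \<open>
  All sums over the lattice below have finitely many nonzero terms when the filters are
  finitely supported and, for the subdivision operator, the dilation is nonsingular;
  \<open>infsum\<close> then is the ordinary finite sum.
\<close>

definition symbol :: "(int ^ 'd \<Rightarrow> complex ^ 'q ^ 'p) \<Rightarrow> real ^ 'd \<Rightarrow> complex ^ 'q ^ 'p" where
  "symbol u \<xi> =
     (\<chi> i j. \<Sum>\<^sub>\<infinity>k. u k $ i $ j * exp (- \<i> * complex_of_real (of_int_vec k \<bullet> \<xi>)))"

definition subdivision ::
  "(int ^ 'd \<Rightarrow> complex ^ 'q ^ 'p) \<Rightarrow> int ^ 'd ^ 'd \<Rightarrow>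
   (int ^ 'd \<Rightarrow> complex ^ 'p ^ 't) \<Rightarrow> int ^ 'd \<Rightarrow> complex ^ 'q ^ 't" where
  "subdivision a M u n =
     sqrt (of_int \<bar>det M\<bar>) *\<^sub>R (\<Sum>\<^sub>\<infinity>k. u k ** a (n - M *v k))"

definition transition ::
  "(int ^ 'd \<Rightarrow> complex ^ 'q ^ 'p) \<Rightarrow> int ^ 'd ^ 'd \<Rightarrow>
   (int ^ 'd \<Rightarrow> complex ^ 'q ^ 't) \<Rightarrow> int ^ 'd \<Rightarrow> complex ^ 'p ^ 't" where
  "transition b M u n =
     sqrt (of_int \<bar>det M\<bar>) *\<^sub>R (\<Sum>\<^sub>\<infinity>k. u k ** ctranspose (b (k - M *v n)))"

text \<open>
  A filter bank is given by a low-pass filter \<open>b0\<close>, high-pass filters \<open>b l\<close> for \<open>l \<in> {1..s}\<close>,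
  and dilations \<open>M l\<close> for \<open>l \<in> {0..s}\<close>; values at other indices are irrelevant.
  Coefficients are pairs \<open>(w, w0)\<close> of the high-pass family, indexed by \<open>{1..s}\<close>,
  and the low-pass component.
\<close>

definition analysis_op ::
  "nat \<Rightarrow> (int ^ 'd \<Rightarrow> complex ^ 'r ^ 'r) \<Rightarrow> (nat \<Rightarrow> int ^ 'd \<Rightarrow> complex ^ 'r ^ 1) \<Rightarrow>
   (nat \<Rightarrow> int ^ 'd ^ 'd) \<Rightarrow> (int ^ 'd \<Rightarrow> complex ^ 'r ^ 1) \<Rightarrow>
   (nat \<Rightarrow> int ^ 'd \<Rightarrow> complex ^ 1 ^ 1) \<times> (int ^ 'd \<Rightarrow> complex ^ 'r ^ 1)" where
  "analysis_op s b0 b M v =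
     ((\<lambda>l\<in>{1..s}. transition (b l) (M l) v), transition b0 (M 0) v)"

fun synthesis_op ::
  "nat \<Rightarrow> (int ^ 'd \<Rightarrow> complex ^ 'r ^ 'r) \<Rightarrow> (nat \<Rightarrow> int ^ 'd \<Rightarrow> complex ^ 'r ^ 1) \<Rightarrow>
   (nat \<Rightarrow> int ^ 'd ^ 'd) \<Rightarrow>
   (nat \<Rightarrow> int ^ 'd \<Rightarrow> complex ^ 1 ^ 1) \<times> (int ^ 'd \<Rightarrow> complex ^ 'r ^ 1) \<Rightarrow>
   int ^ 'd \<Rightarrow> complex ^ 'r ^ 1" where
  "synthesis_op s tb0 tb M (w, w0) =
     (\<lambda>n. subdivision tb0 (M 0) w0 n + (\<Sum>l = 1..s. subdivision (tb l) (M l) (w l) n))"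

primrec decomp_low ::
  "(int ^ 'd \<Rightarrow> complex ^ 'r ^ 'r) \<Rightarrow> (nat \<Rightarrow> int ^ 'd ^ 'd) \<Rightarrow>
   (int ^ 'd \<Rightarrow> complex ^ 'r ^ 1) \<Rightarrow> nat \<Rightarrow> int ^ 'd \<Rightarrow> complex ^ 'r ^ 1" where
  "decomp_low b0 M v 0 = v"
| "decomp_low b0 M v (Suc j) = transition b0 (M 0) (decomp_low b0 M v j)"

text \<open>Only levels \<open>j \<ge> 1\<close> of the high-pass coefficients are meaningful.\<close>

definition decomp_high ::
  "(int ^ 'd \<Rightarrow> complex ^ 'r ^ 'r) \<Rightarrow> (nat \<Rightarrow> int ^ 'd \<Rightarrow> complex ^ 'r ^ 1) \<Rightarrow>
   (nat \<Rightarrow> int ^ 'd ^ 'd) \<Rightarrow> (int ^ 'd \<Rightarrow> complex ^ 'r ^ 1) \<Rightarrow>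
   nat \<Rightarrow> nat \<Rightarrow> int ^ 'd \<Rightarrow> complex ^ 1 ^ 1" where
  "decomp_high b0 b M v l j = transition (b l) (M l) (decomp_low b0 M v (j - 1))"

text \<open>
  \<open>reconstruct s tb0 tb M w j c\<close> runs the reconstruction from level \<open>j\<close> down to level \<open>0\<close>,
  where \<open>c\<close> is the low-pass data at level \<open>j\<close> and \<open>w l i\<close> the high-pass data at level \<open>i\<close>.
\<close>

primrec reconstruct ::
  "nat \<Rightarrow> (int ^ 'd \<Rightarrow> complex ^ 'r ^ 'r) \<Rightarrow> (nat \<Rightarrow> int ^ 'd \<Rightarrow> complex ^ 'r ^ 1) \<Rightarrow>
   (nat \<Rightarrow> int ^ 'd ^ 'd) \<Rightarrow> (nat \<Rightarrow> nat \<Rightarrow> int ^ 'd \<Rightarrow> complex ^ 1 ^ 1) \<Rightarrow>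
   nat \<Rightarrow> (int ^ 'd \<Rightarrow> complex ^ 'r ^ 1) \<Rightarrow> int ^ 'd \<Rightarrow> complex ^ 'r ^ 1" where
  "reconstruct s tb0 tb M w 0 c = c"
| "reconstruct s tb0 tb M w (Suc j) c =
     reconstruct s tb0 tb M w j (synthesis_op s tb0 tb M (\<lambda>l. w l (Suc j), c))"

definition perfect_reconstruction ::
  "nat \<Rightarrow> (int ^ 'd \<Rightarrow> complex ^ 'r ^ 'r) \<Rightarrow> (nat \<Rightarrow> int ^ 'd \<Rightarrow> complex ^ 'r ^ 1) \<Rightarrow>
   (int ^ 'd \<Rightarrow> complex ^ 'r ^ 'r) \<Rightarrow> (nat \<Rightarrow> int ^ 'd \<Rightarrow> complex ^ 'r ^ 1) \<Rightarrow>
   (nat \<Rightarrow> int ^ 'd ^ 'd) \<Rightarrow> nat \<Rightarrow> bool" where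
  "perfect_reconstruction s b0 b tb0 tb M J \<longleftrightarrow>
     (\<forall>v. reconstruct s tb0 tb M (decomp_high b0 b M v) J (decomp_low b0 M v J) = v)"

definition Omega :: "int ^ 'd ^ 'd \<Rightarrow> (real ^ 'd) set" where
  "Omega M = range (\<lambda>k. matrix_inv (transpose (map_matrix of_int M)) *v of_int_vec k)
             \<inter> {x. \<forall>i. 0 \<le> x $ i \<and> x $ i < 1}"

definition dual_framelet_filter_bank ::
  "nat \<Rightarrow> (int ^ 'd \<Rightarrow> complex ^ 'r ^ 'r) \<Rightarrow> (nat \<Rightarrow> int ^ 'd \<Rightarrow> complex ^ 'r ^ 1) \<Rightarrow>
   (int ^ 'd \<Rightarrow> complex ^ 'r ^ 'r) \<Rightarrow> (nat \<Rightarrow> int ^ 'd \<Rightarrow> complex ^ 'r ^ 1) \<Rightarrow>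
   (nat \<Rightarrow> int ^ 'd ^ 'd) \<Rightarrow> bool" where
  "dual_framelet_filter_bank s b0 b tb0 tb M \<longleftrightarrow>
     (AE \<xi> in lebesgue. \<forall>\<omega> \<in> (\<Union>l\<in>{0..s}. Omega (M l)).
        indicator (Omega (M 0)) \<omega> *\<^sub>R
          (ctranspose (symbol b0 \<xi>) ** symbol tb0 (\<xi> + (2 * pi) *\<^sub>R \<omega>)) +
        (\<Sum>l = 1..s. indicator (Omega (M l)) \<omega> *\<^sub>R
          (ctranspose (symbol (b l) \<xi>) ** symbol (tb l) (\<xi> + (2 * pi) *\<^sub>R \<omega>)))
        = (if \<omega> = 0 then mat 1 else 0))"

end

theory Submission
  imports Defs
begin

text \<open>
  Write \<open>e(t) = exp (2 \<pi> \<i> t)\<close> and \<open>A(\<omega>, c) = (\<Sum>l. \<Sum>p. \<chi>\<^sub>l(\<omega>) e(-\<omega> \<bullet> p) b\<^sub>l(p + c)\<^sup>* tb\<^sub>l(p))\<close>, where \<open>\<chi>\<^sub>l\<close> is the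
  indicator function of \<open>Omega (M l)\<close>. As \<open>\<bar>det M\<bar>\<close> times the indicator function of \<open>M \<int>\<^sup>d\<close> is
  \<open>(\<Sum>\<omega>\<in>Omega M. e(\<omega> \<bullet> x))\<close>, synthesis after analysis maps \<open>v\<close> to the sequence
  \<open>n \<mapsto> (\<Sum>c. v(n + c) (\<Sum>\<omega>. e(\<omega> \<bullet> n) A(\<omega>, c)))\<close>; the left-hand side of the dual framelet identity is
  \<open>(\<Sum>c. exp (\<i> c \<bullet> \<xi>) A(\<omega>, c))\<close>. By linear independence of characters, of the lattice in the first case
  and of \<open>\<real>\<^sup>d\<close> in the second, either identity says that \<open>A(0, 0)\<close> is the identity matrix and that
  all other \<open>A(\<omega>, c)\<close> vanish.
\<close>

section \<open>Volume and lattice points\<close>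

text \<open>Volume factors and determinants both multiply under composition, so
  \<open>induct_linear_elementary\<close> reduces the claim to maps with a zero coordinate,
  stretchings, coordinate swaps and shears.\<close>

lemma measure_linear_image_cart:
  fixes f :: "real ^ 'n \<Rightarrow> real ^ 'n"
  assumes "linear f" "S \<in> lmeasurable"
  shows "f ` S \<in> lmeasurable \<and> measure lebesgue (f ` S) = \<bar>det (matrix f)\<bar> * measure lebesgue S"
proof -
  \<comment> \<open>Swaps and shears have determinant of modulus 1. For them the claim is invariance
    of volume, which extends from boxes to all measurable sets.\<close>
  have from_boxes: "\<forall>S\<in>lmeasurable. g ` S \<in> lmeasurable
    \<and> measure lebesgue (g ` S) = \<bar>det (matrix g)\<bar> * measure lebesgue S"
    if "linear g" "\<bar>det (matrix g)\<bar> = 1"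
      "\<And>a b. measure lebesgue (g ` cbox a b) = measure lebesgue (cbox a b)"
    for g :: "real ^ 'n \<Rightarrow> real ^ 'n"
  proof
    fix S :: "(real ^ 'n) set"
    assume "S \<in> lmeasurable"
    then have "g ` S \<in> lmeasurable \<and> 1 * measure lebesgue S = measure lebesgue (g ` S)"
      using that(3) by (intro measure_linear_sufficient[OF that(1)]) simp_all
    then show "g ` S \<in> lmeasurable
      \<and> measure lebesgue (g ` S) = \<bar>det (matrix g)\<bar> * measure lebesgue S"
      using that(2) by simp
  qed
  have "\<forall>S\<in>lmeasurable. f ` S \<in> lmeasurable
    \<and> measure lebesgue (f ` S) = \<bar>det (matrix f)\<bar> * measure lebesgue S"
  proof (rule induct_linear_elementary[OF \<open>linear f\<close>], goal_cases)
    case (1 f g)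
    show ?case
    proof
      fix S :: "(real ^ 'n) set"
      assume S: "S \<in> lmeasurable"
      have "(f \<circ> g) ` S = f ` g ` S"
        by (rule image_comp[symmetric])
      then show "(f \<circ> g) ` S \<in> lmeasurable
        \<and> measure lebesgue ((f \<circ> g) ` S) = \<bar>det (matrix (f \<circ> g))\<bar> * measure lebesgue S"
        using 1 S by (simp add: matrix_compose det_mul abs_mult)
    qed
  next
    case (2 f i)
    \<comment> \<open>Coordinate \<open>i\<close> of the image is always 0, so \<open>f\<close> is
      not surjective and hence not injective. Determinant and image volume then both vanish.\<close>
    then have "\<not> inj f"
      by (metis (full_types) linear_injective_imp_surjective one_neq_zero surjE vec_component)
    then have "det (matrix f) = 0" "negligible (f ` S)" for S
      using det_nz_iff_inj[OF \<open>linear f\<close>] negligible_linear_singular_image[OF \<open>linear f\<close>]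
      by simp_all
    then show ?case
      by (simp add: negligible_iff_measure)
  next
    case (3 c)
    have "det (matrix (\<lambda>x. \<chi> i. c i * x $ i)) = prod c UNIV"
      by (simp add: axis_def matrix_def det_diagonal)
    then show ?case
      by (auto simp: measurable_stretch measure_stretch)
  next
    case (4 m n)
    let ?g = "\<lambda>x :: real ^ 'n. \<chi> i. x $ Transposition.transpose m n i"
    show ?case
    proof (rule from_boxes)
      show "linear ?g"
        by (rule linearI) (simp_all add: vec_eq_iff)
      have "matrix ?g = (\<chi> i. mat 1 $ Transposition.transpose m n i)"
        by (auto simp: matrix_def mat_def axis_def vec_eq_iff)
      then show "\<bar>det (matrix ?g)\<bar> = 1"
        by (simp add: det_permute_rows permutes_swap_id sign_swap_id abs_mult)
    next
      fix a b :: "real ^ 'n"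
      \<comment> \<open>The swap is an involution, so the image of a box is its preimage, and this
        is the box with swapped corners.\<close>
      have invol: "?g (?g x) = x" for x
        by (simp add: vec_eq_iff)
      have "?g ` cbox a b = ?g -` cbox a b"
      proof (intro set_eqI iffI)
        fix x assume "x \<in> ?g -` cbox a b"
        then show "x \<in> ?g ` cbox a b"
          by (intro image_eqI[where x = "?g x"]) (simp_all add: invol)
      next
        fix x assume "x \<in> ?g ` cbox a b"
        then show "x \<in> ?g -` cbox a b"
          by (elim imageE) (simp add: invol)
      qed
      also have "\<dots> = cbox (?g a) (?g b)"
      proof (intro set_eqI)
        fix x
        have "(\<forall>i. P (Transposition.transpose m n i)) \<longleftrightarrow> (\<forall>i. P i)" for P
          by (metis transpose_involutory)
        from this[of "\<lambda>i. a $ i \<le> x $ Transposition.transpose m n i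
          \<and> x $ Transposition.transpose m n i \<le> b $ i"]
        show "x \<in> ?g -` cbox a b \<longleftrightarrow> x \<in> cbox (?g a) (?g b)"
          by (simp add: mem_box_cart)
      qed
      finally have eq: "?g ` cbox a b = cbox (?g a) (?g b)" .
      have "cbox (?g a) (?g b) = {} \<longleftrightarrow> cbox a b = {}"
        by (simp flip: eq)
      moreover have "(\<Prod>i\<in>UNIV. ?g b $ i - ?g a $ i) = (\<Prod>i\<in>UNIV. b $ i - a $ i)"
        using prod.permute[OF permutes_swap_id, where S = UNIV
          and g = "\<lambda>i. b $ i - a $ i", symmetric]
        by (simp add: o_def)
      ultimately show "measure lebesgue (?g ` cbox a b) = measure lebesgue (cbox a b)"
        unfolding eq by (simp add: content_cbox_if_cart)
    qed
  next
    case (5 m n)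
    let ?g = "\<lambda>x :: real ^ 'n. \<chi> i. if i = m then x $ m + x $ n else x $ i"
    show ?case
    proof (rule from_boxes)
      show lin: "linear ?g"
        by (rule linearI) (auto simp: vec_eq_iff algebra_simps)
      have "matrix ?g = (\<chi> i. if i = m then row m (mat 1) + 1 *s row n (mat 1) else row i (mat 1))"
        using \<open>m \<noteq> n\<close> by (auto simp: matrix_def mat_def axis_def vec_eq_iff row_def)
      then show "\<bar>det (matrix ?g)\<bar> = 1"
        using \<open>m \<noteq> n\<close> by (simp add: det_row_operation del: vector_smult_lid)
      fix a b :: "real ^ 'n"
      show "measure lebesgue (?g ` cbox a b) = measure lebesgue (cbox a b)"
      proof (cases "cbox a b = {}")
        case False
        \<comment> \<open>Moving the lower corner to the origin brings the box into the form that
          \<open>measure_shear_interval\<close> accepts. By linearity the image of the box is merely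
          translated.\<close>
        have shift: "cbox a b = (+) a ` cbox 0 (b - a)"
          by (simp only: cbox_translation[symmetric] add_0_right add_diff_cancel_left') simp
        have "?g ` (+) a ` cbox 0 (b - a) = (+) (?g a) ` ?g ` cbox 0 (b - a)"
          by (simp only: image_comp o_def linear_add[OF lin])
        then have "measure lebesgue (?g ` (+) a ` cbox 0 (b - a))
          = measure lebesgue (?g ` cbox 0 (b - a))"
          by (simp only: measure_translation)
        also have "\<dots> = measure lebesgue (cbox 0 (b - a))"
        proof (rule measure_shear_interval)
          show "cbox 0 (b - a) \<noteq> {}"
            using False shift by (metis image_empty)
        qed (use \<open>m \<noteq> n\<close> in simp_all)
        also have "\<dots> = measure lebesgue ((+) a ` cbox 0 (b - a))"
          by (simp only: measure_translation)
        finally show ?thesis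
          unfolding shift .
      qed simp
    qed
  qed
  then show ?thesis
    using \<open>S \<in> lmeasurable\<close> by blast
qed

section \<open>The half-open unit cube and integer parts\<close>

definition unit_cube :: "(real ^ 'd) set" where
  "unit_cube = {x. \<forall>i. 0 \<le> x $ i \<and> x $ i < 1}"

definition floor_vec :: "real ^ 'd \<Rightarrow> int ^ 'd" where
  "floor_vec x = (\<chi> i. \<lfloor>x $ i\<rfloor>)"

abbreviation real_matrix :: "int ^ 'd ^ 'd \<Rightarrow> real ^ 'd ^ 'd" where
  "real_matrix M \<equiv> map_matrix of_int M"

lemma of_int_vec_nth [simp]: "of_int_vec k $ i = of_int (k $ i)"
  by (simp add: of_int_vec_def)

lemma of_int_vec_add: "of_int_vec (k + l) = of_int_vec k + of_int_vec l"
  and of_int_vec_diff: "of_int_vec (k - l) = of_int_vec k - of_int_vec l"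
  and of_int_vec_zero [simp]: "of_int_vec 0 = 0"
  by (simp_all add: vec_eq_iff)

lemma of_int_vec_eq_iff [simp]: "of_int_vec k = of_int_vec l \<longleftrightarrow> k = l"
  by (simp add: vec_eq_iff)

lemma of_int_vec_mult: "of_int_vec (M *v k) = real_matrix M *v of_int_vec k"
  by (simp add: vec_eq_iff matrix_vector_mult_def)

lemma inner_of_int_vec: "of_int_vec k \<bullet> of_int_vec l = of_int (\<Sum>i\<in>UNIV. k $ i * l $ i)"
  by (simp add: inner_vec_def)

lemma det_map_matrix_of_int:
  "det (map_matrix of_int M :: 'a::comm_ring_1 ^ 'd ^ 'd) = of_int (det M)"
  by (simp add: det_def)

lemma transpose_map_matrix: "transpose (map_matrix f M) = map_matrix f (transpose M)"
  by (simp add: transpose_def vec_eq_iff)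

text \<open>Since the cube is half-open, its integer translates tile space without overlap, and
  \<open>floor_vec x\<close> names the only tile that contains \<open>x\<close>.\<close>

lemma diff_floor_vec_in_unit_cube: "x - of_int_vec k \<in> unit_cube \<longleftrightarrow> k = floor_vec x"
proof -
  have "(0 \<le> x $ i - of_int (k $ i) \<and> x $ i - of_int (k $ i) < 1) \<longleftrightarrow> k $ i = \<lfloor>x $ i\<rfloor>" for i
    by linarith
  then show ?thesis
    by (simp add: unit_cube_def floor_vec_def vec_eq_iff)
qed

lemma floor_vec_add_of_int_vec: "floor_vec (x + of_int_vec k) = floor_vec x + k"
  by (simp add: floor_vec_def vec_eq_iff)

lemma unit_cube_borel [measurable]: "unit_cube \<in> sets borel"
proof -
  have "unit_cube = (\<Inter>i. {x :: real ^ 'd. 0 \<le> x $ i} \<inter> {x. x $ i < 1})"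
    by (auto simp: unit_cube_def)
  also have "\<dots> \<in> sets borel"
    by (intro sets.finite_INT sets.Int borel_closed borel_open closed_Collect_le open_Collect_less
        continuous_intros) auto
  finally show ?thesis .
qed

text \<open>The cube is squeezed between an open and a closed box, both of volume 1.\<close>

lemma unit_cube_lmeasurable: "(unit_cube :: (real ^ 'd) set) \<in> lmeasurable"
  and emeasure_unit_cube: "emeasure lborel (unit_cube :: (real ^ 'd) set) = 1"
proof -
  have "(\<Prod>i\<in>Basis. (1 - 0 :: real ^ 'd) \<bullet> i) = 1"
    by (intro prod.neutral) (auto simp: Basis_vec_def inner_axis)
  then have box: "emeasure lborel (box 0 (1 :: real ^ 'd)) = 1"
    "emeasure lborel (cbox 0 (1 :: real ^ 'd)) = 1"
    by (simp_all add: emeasure_lborel_box_eq emeasure_lborel_cbox_eq)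
      (auto simp: Basis_vec_def inner_axis)
  have "box 0 1 \<subseteq> (unit_cube :: (real ^ 'd) set)" "unit_cube \<subseteq> cbox 0 (1 :: real ^ 'd)"
    by (auto simp: unit_cube_def mem_box_cart less_imp_le)
  then show one: "emeasure lborel (unit_cube :: (real ^ 'd) set) = 1"
    using box emeasure_mono[of "box 0 1" "unit_cube :: (real ^ 'd) set" lborel]
      emeasure_mono[of unit_cube "cbox 0 (1 :: real ^ 'd)" lborel]
    by (auto intro: antisym)
  show "(unit_cube :: (real ^ 'd) set) \<in> lmeasurable"
    by (rule fmeasurableI) (auto simp: one)
qed

text \<open>
  The image \<open>P\<close> of the unit cube under \<open>N\<close> has volume \<open>\<bar>det N\<bar>\<close> and is a fundamental domain of the
  lattice \<open>N \<int>\<^sup>d\<close>. Cutting \<open>P\<close> along the integer translates of the cube and moving the pieces back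
  into the cube covers each point of the cube as often as \<open>P\<close> has integer points.
\<close>
lemma card_int_points:
  fixes N :: "int ^ 'd ^ 'd"
  assumes "det N \<noteq> 0" and inv: "R ** real_matrix N = mat 1"
  defines "K \<equiv> {k. R *v of_int_vec k \<in> unit_cube}"
  shows "finite K" "card K = nat \<bar>det N\<bar>"
proof -
  have inv': "real_matrix N ** R = mat 1"
    using inv matrix_left_right_inverse by blast
  have RN: "R *v (real_matrix N *v x) = x" and NR: "real_matrix N *v (R *v x) = x" for x
    by (simp_all add: matrix_vector_mul_assoc inv inv')
  define P where "P = {x. R *v x \<in> unit_cube}"
  have P_image: "P = (*v) (real_matrix N) ` unit_cube"
    using NR by (auto simp: P_def RN intro!: image_eqI[where x = "R *v _"])
  have [measurable]: "P \<in> sets borel"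
  proof -
    have "(*v) R \<in> borel_measurable borel"
      by (intro borel_measurable_continuous_onI continuous_intros)
    then show ?thesis
      using measurable_sets[of "(*v) R" borel borel unit_cube] by (simp add: P_def vimage_def)
  qed
  have "P \<in> lmeasurable"
    "measure lebesgue P = \<bar>det (real_matrix N)\<bar> * measure lebesgue (unit_cube :: (real ^ 'd) set)"
    unfolding P_image using measure_linear_image_cart[OF matrix_vector_mul_linear
      unit_cube_lmeasurable, of "real_matrix N"]
    by simp_all
  moreover have "measure lebesgue (unit_cube :: (real ^ 'd) set) = 1"
    by (simp add: measure_def emeasure_unit_cube)
  ultimately have vol: "emeasure lborel P = ennreal \<bar>of_int (det N)\<bar>"
    using emeasure_eq_measure2[of P lebesgue] by (simp add: det_map_matrix_of_int fmeasurable_def)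

  \<comment> \<open>Integer points of \<open>P\<close> and of its translates both represent the
    classes of integer vectors modulo \<open>N\<close>, once each. Counting measure is used because
    finiteness of \<open>K\<close> is not yet known.\<close>
  have points: "emeasure (count_space UNIV) {k. x + of_int_vec k \<in> P}
    = emeasure (count_space UNIV) K" for x
  proof -
    \<comment> \<open>\<open>shift y k\<close> subtracts the vector of the lattice spanned by
      \<open>N\<close> that carries \<open>y + k\<close> into the fundamental domain
      \<open>P\<close>.\<close>
    define shift :: "real ^ 'd \<Rightarrow> int ^ 'd \<Rightarrow> int ^ 'd"
      where "shift y k = k - N *v floor_vec (R *v (y + of_int_vec k))" for y k
    have R_shift: "R *v of_int_vec (shift y k)
      = R *v of_int_vec k - of_int_vec (floor_vec (R *v (y + of_int_vec k)))" for y k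
      by (simp add: shift_def of_int_vec_diff of_int_vec_mult matrix_vector_mult_diff_distrib RN)
    have R_shift': "R *v (z + of_int_vec (shift y k))
      = R *v (z + of_int_vec k) - of_int_vec (floor_vec (R *v (y + of_int_vec k)))" for y z k
      by (simp add: matrix_vector_right_distrib R_shift)
    have in_cube: "R *v (y + of_int_vec (shift y k)) \<in> unit_cube" for y k
      unfolding R_shift' by (simp add: diff_floor_vec_in_unit_cube)
    \<comment> \<open>\<open>shift y\<close> stays in the class of \<open>k\<close> modulo
      \<open>N\<close>. If \<open>z + k\<close> lies in \<open>P\<close>, then \<open>k\<close> is
      the representative of this class that \<open>shift z\<close> selects.\<close>
    have inverse: "shift z (shift y k) = k" if "R *v (z + of_int_vec k) \<in> unit_cube" for y z k
    proof -
      have "floor_vec (R *v (z + of_int_vec k)) = 0"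
        using that diff_floor_vec_in_unit_cube[of _ 0] by (metis diff_zero of_int_vec_zero)
      then have "floor_vec (R *v (z + of_int_vec (shift y k)))
        = - floor_vec (R *v (y + of_int_vec k))"
        unfolding R_shift'
        using floor_vec_add_of_int_vec[of "R *v (z + of_int_vec k)"
          "- floor_vec (R *v (y + of_int_vec k))"]
        by (simp add: of_int_vec_diff[of 0, simplified])
      moreover have "N *v (- a) = - (N *v a)" for a
        by (simp add: matrix_vector_mult_def vec_eq_iff sum_negf)
      ultimately show ?thesis
        by (simp add: shift_def[of z] shift_def[of y])
    qed
    have "bij_betw (shift 0) {k. x + of_int_vec k \<in> P} K"
      using in_cube[of 0] in_cube[of x] inverse[where y = x and z = 0]
        inverse[where y = 0 and z = x]
      by (intro bij_betwI[where g = "shift x"]) (auto simp: K_def P_def)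
    then show ?thesis
      using bij_betw_finite bij_betw_same_card by (fastforce simp: emeasure_count_space)
  qed
  \<comment> \<open>Exactly one \<open>k\<close> puts \<open>x - k\<close> into the cube, so a sum
    over \<open>k\<close> can be inserted. Tonelli, translation of each piece by \<open>k\<close>,
    and Tonelli again turn the volume into a count.\<close>
  have "emeasure lborel P = (\<integral>\<^sup>+x. indicator P x \<partial>lborel)"
    by simp
  also have "\<dots> = (\<integral>\<^sup>+x.
    (\<integral>\<^sup>+k. indicator unit_cube (x - of_int_vec k) * indicator P x \<partial>count_space UNIV) \<partial>lborel)"
  proof (rule nn_integral_cong)
    fix x :: "real ^ 'd"
    have "indicator unit_cube (x - of_int_vec k) * indicator P x
      = indicator P x * (indicator {floor_vec x} k :: ennreal)" for k
      by (auto simp: indicator_def diff_floor_vec_in_unit_cube)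
    then show "(indicator P x :: ennreal)
      = (\<integral>\<^sup>+k. indicator unit_cube (x - of_int_vec k) * indicator P x \<partial>count_space UNIV)"
      by (simp add: nn_integral_cmult)
  qed
  also have "\<dots> = (\<integral>\<^sup>+k. (\<integral>\<^sup>+x. indicator unit_cube (x - of_int_vec k) * indicator P x \<partial>lborel)
    \<partial>count_space UNIV)"
    by (rule nn_integral_count_space_nn_integral) auto
  also have "\<dots> = (\<integral>\<^sup>+k. (\<integral>\<^sup>+x. indicator unit_cube x * indicator P (x + of_int_vec k) \<partial>lborel)
    \<partial>count_space UNIV)"
  proof (rule nn_integral_cong)
    fix k
    show "(\<integral>\<^sup>+x. (indicator unit_cube (x - of_int_vec k) :: ennreal) * indicator P x \<partial>lborel)
      = (\<integral>\<^sup>+x. indicator unit_cube x * indicator P (x + of_int_vec k) \<partial>lborel)"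
      by (subst lborel_distr_plus[of "of_int_vec k", symmetric])
        (simp add: nn_integral_distr add.commute)
  qed
  also have "\<dots> = (\<integral>\<^sup>+x.
    (\<integral>\<^sup>+k. indicator unit_cube x * indicator P (x + of_int_vec k) \<partial>count_space UNIV) \<partial>lborel)"
    by (rule nn_integral_count_space_nn_integral[symmetric]) auto
  also have "\<dots> = (\<integral>\<^sup>+x. emeasure (count_space UNIV) K
    * indicator (unit_cube :: (real ^ 'd) set) x \<partial>lborel)"
  proof (rule nn_integral_cong)
    fix x :: "real ^ 'd"
    have "(indicator P (x + of_int_vec k) :: ennreal) = indicator {k. x + of_int_vec k \<in> P} k" for k
      by (simp add: indicator_def)
    then show "(\<integral>\<^sup>+k. (indicator unit_cube x :: ennreal)
      * indicator P (x + of_int_vec k) \<partial>count_space UNIV)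
      = emeasure (count_space UNIV) K * indicator unit_cube x"
      using points[of x] by (simp add: nn_integral_cmult mult.commute)
  qed
  also have "\<dots> = emeasure (count_space UNIV) K"
    by (simp add: nn_integral_cmult emeasure_unit_cube)
  finally have count: "emeasure (count_space UNIV) K = ennreal \<bar>of_int (det N)\<bar>"
    using vol by simp
  \<comment> \<open>An infinite set has infinite counting measure, whereas the volume of
    \<open>P\<close> is finite.\<close>
  show "finite K"
  proof (rule ccontr)
    assume "infinite K"
    then show False
      using count by (simp add: emeasure_count_space_infinite)
  qed
  then have "ennreal (real (card K)) = ennreal \<bar>of_int (det N)\<bar>"
    using count by (simp add: emeasure_count_space_finite ennreal_of_nat_eq_real_of_nat)
  then show "card K = nat \<bar>det N\<bar>"
    by (simp add: ennreal_inj)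
qed

section \<open>Dilation matrices and their frequency sets\<close>

lemma dilation_matrix_det_nonzero:
  fixes M :: "int ^ 'd ^ 'd"
  assumes "dilation_matrix M"
  shows "det M \<noteq> 0"
proof
  assume "det M = 0"
  then have "det (map_matrix of_int M :: complex ^ 'd ^ 'd) = 0"
    by (simp add: det_map_matrix_of_int)
  \<comment> \<open>A nonzero kernel vector is an eigenvector for the eigenvalue 0, which the
    dilation property excludes.\<close>
  then obtain v :: "complex ^ 'd" where "v \<noteq> 0" "map_matrix of_int M *v v = 0"
    by (metis invertible_det_nz invertible_left_inverse matrix_left_invertible_ker)
  then have "norm (0 :: complex) > 1"
    using assms unfolding dilation_matrix_def by (metis vector_smult_lzero)
  then show False
    by simp
qed

lemma matrix_inv_real_matrix:
  assumes "det M \<noteq> 0"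
  shows "matrix_inv (real_matrix M) ** real_matrix M = mat 1"
    and "real_matrix M ** matrix_inv (real_matrix M) = mat 1"
proof -
  have "invertible (real_matrix M)"
    using assms by (simp add: invertible_det_nz det_map_matrix_of_int)
  then have "\<exists>R. real_matrix M ** R = mat 1 \<and> R ** real_matrix M = mat 1"
    by (simp add: invertible_def)
  then have "real_matrix M ** matrix_inv (real_matrix M) = mat 1
    \<and> matrix_inv (real_matrix M) ** real_matrix M = mat 1"
    unfolding matrix_inv_def by (rule someI_ex)
  then show "matrix_inv (real_matrix M) ** real_matrix M = mat 1"
    "real_matrix M ** matrix_inv (real_matrix M) = mat 1"
    by auto
qed

lemma inj_int_matrix:
  fixes M :: "int ^ 'd ^ 'd"
  assumes "det M \<noteq> 0"
  shows "inj ((*v) M)"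
proof (rule injI)
  fix k l assume "M *v k = M *v l"
  then have "real_matrix M *v of_int_vec k = real_matrix M *v of_int_vec l"
    by (simp flip: of_int_vec_mult)
  then have "matrix_inv (real_matrix M) *v (real_matrix M *v of_int_vec k)
    = matrix_inv (real_matrix M) *v (real_matrix M *v of_int_vec l)"
    by simp
  then show "k = l"
    by (simp add: matrix_vector_mul_assoc matrix_inv_real_matrix assms)
qed

lemma Omega_eq:
  "Omega M = {\<omega> \<in> unit_cube. \<exists>k. \<omega> = matrix_inv (real_matrix (transpose M)) *v of_int_vec k}"
  by (auto simp: Omega_def unit_cube_def transpose_map_matrix)

text \<open>Clearing the inverse turns membership into integrality of the transposed image, a
  condition that is easily checked for sums of frequencies.\<close>

lemma Omega_eq':
  assumes "det M \<noteq> 0"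
  shows "Omega M = {\<omega> \<in> unit_cube. \<exists>k. real_matrix (transpose M) *v \<omega> = of_int_vec k}"
proof -
  have "\<omega> = matrix_inv (real_matrix (transpose M)) *v y
    \<longleftrightarrow> real_matrix (transpose M) *v \<omega> = y" for \<omega> y
    using matrix_inv_real_matrix[of "transpose M"] assms by (auto simp: matrix_vector_mul_assoc)
  then show ?thesis
    by (simp add: Omega_eq)
qed

text \<open>The inverse transpose maps the integer vectors counted by
  \<open>card_int_points\<close>, applied to \<open>transpose M\<close>, bijectively onto
  \<open>Omega M\<close>.\<close>

lemma
  assumes "det M \<noteq> 0"
  shows finite_Omega: "finite (Omega M)"
    and card_Omega: "card (Omega M) = nat \<bar>det M\<bar>"
proof -
  let ?R = "matrix_inv (real_matrix (transpose M))"
  let ?K = "{k. ?R *v of_int_vec k \<in> unit_cube}"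
  have det: "det (transpose M) \<noteq> 0"
    using assms by simp
  note inv = matrix_inv_real_matrix[OF det]
  have "inj_on (\<lambda>k. ?R *v of_int_vec k) ?K"
  proof (rule inj_onI)
    fix k l assume "?R *v of_int_vec k = ?R *v of_int_vec l"
    then have "real_matrix (transpose M) *v (?R *v of_int_vec k)
      = real_matrix (transpose M) *v (?R *v of_int_vec l)"
      by simp
    then show "k = l"
      by (simp add: matrix_vector_mul_assoc inv)
  qed
  moreover have "Omega M = (\<lambda>k. ?R *v of_int_vec k) ` ?K"
    by (auto simp: Omega_eq)
  ultimately show "finite (Omega M)" "card (Omega M) = nat \<bar>det M\<bar>"
    using card_int_points[OF det inv(1)] by (simp_all add: card_image)
qed

lemma Omega_subset_unit_cube: "Omega M \<subseteq> unit_cube"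
  by (auto simp: Omega_eq)

lemma zero_in_Omega: "0 \<in> Omega M"
  by (auto simp: Omega_eq unit_cube_def intro!: exI[of _ 0])

section \<open>Characters\<close>

text \<open>Dedekind's argument, by induction on the number of characters. It is stated for
  arbitrary additive monoids so that it serves both the lattice and real space.\<close>

lemma independent_characters:
  fixes f :: "'i \<Rightarrow> 'a::monoid_add \<Rightarrow> 'b::idom"
  assumes "finite I"
    and "\<And>i x y. i \<in> I \<Longrightarrow> f i (x + y) = f i x * f i y"
    and "\<And>i. i \<in> I \<Longrightarrow> f i 0 = 1"
    and "inj_on f I"
    and "\<And>x. (\<Sum>i\<in>I. c i * f i x) = 0"
    and "i \<in> I"
  shows "c i = 0"
  using assms
proof (induction I arbitrary: c i rule: finite_induct)
  case (insert a I)
  have zero: "c i = 0" if "i \<in> I" for i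
  proof -
    have "f i \<noteq> f a"
      using insert.prems(3) insert.hyps \<open>i \<in> I\<close> by (auto simp: inj_on_def)
    then obtain y where y: "f i y \<noteq> f a y"
      by (meson ext)
    have sum: "(\<Sum>i\<in>I. c i * f i x) = - c a * f a x" for x
      using insert.prems(4)[of x] insert.hyps by (simp add: eq_neg_iff_add_eq_0 add.commute)
    \<comment> \<open>Shifting the relation by \<open>y\<close> and subtracting \<open>f a y\<close>
      times the original cancels the term of \<open>a\<close>. Each remaining coefficient gains a
      factor, and the factor for the chosen \<open>i\<close> is nonzero.\<close>
    have "(\<Sum>i\<in>I. c i * (f i y - f a y) * f i x) = 0" for x
    proof -
      have "(\<Sum>i\<in>I. c i * (f i y - f a y) * f i x)
        = (\<Sum>i\<in>I. c i * f i (y + x) - f a y * (c i * f i x))"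
        by (rule sum.cong) (simp_all add: insert.prems(1) algebra_simps)
      also have "\<dots> = (\<Sum>i\<in>I. c i * f i (y + x)) - f a y * (\<Sum>i\<in>I. c i * f i x)"
        by (simp add: sum_distrib_left sum_subtractf)
      also have "\<dots> = 0"
        unfolding sum by (simp add: insert.prems(1))
      finally show ?thesis .
    qed
    moreover have "inj_on f I"
      using insert.prems(3) by (rule inj_on_subset) blast
    ultimately have "c i * (f i y - f a y) = 0"
      using insert.prems(1,2) \<open>i \<in> I\<close> by (intro insert.IH[of "\<lambda>i. c i * (f i y - f a y)"]) simp_all
    then show ?thesis
      using y by simp
  qed
  moreover have "c a = 0"
    using insert.prems(4)[of 0] insert.hyps zero by (simp add: insert.prems(2))
  ultimately show ?case
    using insert.prems(5) by auto
qed simp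

lemma cis_2pi_eq_1_iff: "cis (2 * pi * x) = 1 \<longleftrightarrow> x \<in> \<int>"
proof
  assume "cis (2 * pi * x) = 1"
  then have "cos (2 * pi * x) = 1"
    by (metis cis.simps(1) one_complex.simps(1))
  then obtain n :: int where "2 * pi * x = of_int n * 2 * pi"
    unfolding cos_one_2pi_int by blast
  then show "x \<in> \<int>"
    by simp
qed simp

lemma cis_inner_of_int_vec: "cis (2 * pi * (of_int_vec k \<bullet> of_int_vec l)) = 1"
  by (simp only: inner_of_int_vec cis_2pi_eq_1_iff Ints_of_int)

lemma cis_inner_diff_of_int_vec:
  "cis (2 * pi * ((x - of_int_vec k) \<bullet> of_int_vec l)) = cis (2 * pi * (x \<bullet> of_int_vec l))"
  using cis_inner_of_int_vec[of k l]
  by (simp add: inner_diff_left right_diff_distrib flip: cis_divide)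

text \<open>Translation is injective modulo integer vectors, and the cube contains one point of each
  class.\<close>

lemma inj_on_unit_cube_translate:
  fixes y :: "real ^ 'd"
  shows
  "inj_on (\<lambda>x. x + y - of_int_vec (floor_vec (x + y))) unit_cube"
proof (rule inj_onI)
  fix x z :: "real ^ 'd"
  assume xz: "x \<in> unit_cube" "z \<in> unit_cube"
    and eq: "x + y - of_int_vec (floor_vec (x + y)) = z + y - of_int_vec (floor_vec (z + y))"
  then have x: "x = z - of_int_vec (floor_vec (z + y) - floor_vec (x + y))"
    by (simp add: of_int_vec_diff algebra_simps)
  have "floor_vec (z + y) - floor_vec (x + y) = floor_vec z"
    using xz x diff_floor_vec_in_unit_cube by metis
  also have "\<dots> = 0"
    using xz diff_floor_vec_in_unit_cube[of z 0] by simp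
  finally show "x = z"
    using x by simp
qed

lemma inner_transpose_real_matrix:
  "(real_matrix (transpose M) *v x) \<bullet> y = x \<bullet> (real_matrix M *v y)"
  by (metis dot_lmul_matrix transpose_map_matrix transpose_matrix_vector)

lemma of_int_vec_axis [simp]: "of_int_vec (axis i 1) = axis i 1"
  by (simp add: vec_eq_iff axis_def)

text \<open>Orthogonality of characters of the lattice modulo the image of \<open>M\<close>. On that
  image all terms are 1; elsewhere translating the frequencies multiplies the sum by a factor other
  than 1.\<close>

lemma sum_Omega_cis:
  fixes M :: "int ^ 'd ^ 'd"
  assumes "det M \<noteq> 0"
  shows "(\<Sum>\<omega>\<in>Omega M. cis (2 * pi * (\<omega> \<bullet> of_int_vec x)))
    = (if x \<in> range ((*v) M) then of_int \<bar>det M\<bar> else 0)"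
proof (cases "x \<in> range ((*v) M)")
  case True
  then obtain k where x: "x = M *v k"
    by auto
  have "cis (2 * pi * (\<omega> \<bullet> of_int_vec x)) = 1" if \<omega>: "\<omega> \<in> Omega M" for \<omega>
  proof -
    obtain j where j: "real_matrix (transpose M) *v \<omega> = of_int_vec j"
      using \<omega> unfolding Omega_eq'[OF assms] by blast
    have "\<omega> \<bullet> of_int_vec x = of_int_vec j \<bullet> of_int_vec k"
      by (simp only: x of_int_vec_mult j[symmetric] inner_transpose_real_matrix)
    then show ?thesis
      by (simp add: cis_inner_of_int_vec)
  qed
  then show ?thesis
    using True by (simp add: card_Omega assms)
next
  case False
  let ?e = "\<lambda>\<omega>. cis (2 * pi * (\<omega> \<bullet> of_int_vec x))"
  let ?y = "matrix_inv (real_matrix M) *v of_int_vec x"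
  let ?N = "real_matrix (transpose M)"
  note inv = matrix_inv_real_matrix[OF assms]
  have x: "of_int_vec x = real_matrix M *v ?y"
    by (simp add: matrix_vector_mul_assoc inv)
  have "?y \<noteq> of_int_vec (floor_vec ?y)"
  proof
    assume "?y = of_int_vec (floor_vec ?y)"
    then have "of_int_vec x = of_int_vec (M *v floor_vec ?y)"
      using x by (simp add: of_int_vec_mult)
    then show False
      using False by simp
  qed
  then obtain i where i: "?y $ i \<noteq> of_int \<lfloor>?y $ i\<rfloor>"
    by (auto simp: vec_eq_iff floor_vec_def)
  \<comment> \<open>This dual lattice vector is chosen so that its inner product with
    \<open>x\<close> is the nonintegral coordinate \<open>i\<close> of \<open>?y\<close>.\<close>
  define \<omega>0 where "\<omega>0 = matrix_inv ?N *v axis i 1"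
  have N\<omega>0: "?N *v \<omega>0 = axis i 1"
    unfolding \<omega>0_def matrix_vector_mul_assoc by (subst matrix_inv_real_matrix) (simp_all add: assms)
  have "\<omega>0 \<bullet> of_int_vec x = \<omega>0 \<bullet> (real_matrix M *v ?y)"
    using x by simp
  also have "\<dots> = axis i 1 \<bullet> ?y"
    by (simp only: N\<omega>0[symmetric] inner_transpose_real_matrix)
  also have "\<dots> = ?y $ i"
    by (simp add: inner_axis')
  finally have e\<omega>0: "?e \<omega>0 \<noteq> 1"
    using i unfolding cis_2pi_eq_1_iff by (auto elim: Ints_cases)
  \<comment> \<open>Translation by \<omega>0, reduced into the cube, permutes
    \<open>Omega M\<close>. The integer vector removed does not affect the character at
    \<open>x\<close>.\<close>
  define t where "t \<omega> = \<omega> + \<omega>0 - of_int_vec (floor_vec (\<omega> + \<omega>0))" for \<omega>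
  have "t \<omega> \<in> Omega M" if \<omega>: "\<omega> \<in> Omega M" for \<omega>
  proof -
    obtain j where "?N *v \<omega> = of_int_vec j"
      using \<omega> unfolding Omega_eq'[OF assms] by blast
    then have "?N *v t \<omega> = of_int_vec (j + axis i 1 - transpose M *v floor_vec (\<omega> + \<omega>0))"
      by (simp only: t_def matrix_vector_mult_diff_distrib matrix_vector_right_distrib N\<omega>0
        of_int_vec_add
          of_int_vec_diff of_int_vec_mult of_int_vec_axis)
    moreover have "t \<omega> \<in> unit_cube"
      by (simp add: t_def diff_floor_vec_in_unit_cube)
    ultimately show ?thesis
      using Omega_eq'[OF assms] by auto
  qed
  moreover have "inj_on t (Omega M)"
    unfolding t_def using inj_on_unit_cube_translate Omega_subset_unit_cube by (rule inj_on_subset)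
  ultimately have "bij_betw t (Omega M) (Omega M)"
    by (simp add: bij_betw_def endo_inj_surj finite_Omega assms image_subset_iff)
  then have "sum ?e (Omega M) = (\<Sum>\<omega>\<in>Omega M. ?e (t \<omega>))"
    by (rule sum.reindex_bij_betw[symmetric])
  also have "\<dots> = (\<Sum>\<omega>\<in>Omega M. ?e \<omega> * ?e \<omega>0)"
    unfolding t_def cis_inner_diff_of_int_vec by (simp add: inner_add_left distrib_left cis_mult)
  also have "\<dots> = sum ?e (Omega M) * ?e \<omega>0"
    by (simp add: sum_distrib_right)
  finally show ?thesis
    using e\<omega>0 False by simp
qed

text \<open>Evaluation at the unit vectors determines each coordinate modulo 1, hence exactly within
  the cube.\<close>

lemma inj_on_cis_of_int_vec:
  "inj_on (\<lambda>\<omega> n. cis (2 * pi * (\<omega> \<bullet> of_int_vec n))) unit_cube"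
proof (rule inj_onI)
  fix x y :: "real ^ 'd"
  assume xy: "x \<in> unit_cube" "y \<in> unit_cube"
    and eq: "(\<lambda>n. cis (2 * pi * (x \<bullet> of_int_vec n))) = (\<lambda>n. cis (2 * pi * (y \<bullet> of_int_vec n)))"
  show "x = y"
    unfolding vec_eq_iff
  proof
    fix i
    have "cis (2 * pi * x $ i) = cis (2 * pi * y $ i)"
      using fun_cong[OF eq, of "axis i 1"] by (simp add: inner_axis)
    then have "cis (2 * pi * (x $ i - y $ i)) = 1"
      by (simp add: right_diff_distrib flip: cis_divide)
    then obtain k :: int where "x $ i - y $ i = of_int k"
      unfolding cis_2pi_eq_1_iff by (auto elim: Ints_cases)
    then show "x $ i = y $ i"
      using xy by (auto simp: unit_cube_def) (smt (verit) of_int_1 of_int_less_iff of_int_minus)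
  qed
qed

lemma inj_cis_inner: "inj (\<lambda>c \<xi>. cis (of_int_vec c \<bullet> \<xi>))"
proof (rule injI)
  fix k l :: "int ^ 'd"
  assume eq: "(\<lambda>\<xi>. cis (of_int_vec k \<bullet> \<xi>)) = (\<lambda>\<xi>. cis (of_int_vec l \<bullet> \<xi>))"
  show "k = l"
    unfolding vec_eq_iff
  proof (rule allI, rule ccontr)
    fix i
    assume "k $ i \<noteq> l $ i"
    \<comment> \<open>With this \<open>t\<close> the two characters differ along axis
      \<open>i\<close> by the factor \<open>cis pi\<close>, which is -1.\<close>
    define t where "t = pi / (of_int (k $ i) - of_int (l $ i))"
    have "cis (of_int (k $ i) * t) = cis (of_int (l $ i) * t)"
      using fun_cong[OF eq, of "axis i t"] by (simp add: inner_axis)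
    then have "cis ((of_int (k $ i) - of_int (l $ i)) * t) = 1"
      by (simp add: left_diff_distrib flip: cis_divide)
    then show False
      using \<open>k $ i \<noteq> l $ i\<close> by (simp add: t_def)
  qed
qed

section \<open>Correlations of filters\<close>

lemma infsum_eq_sum:
  fixes f :: "'a \<Rightarrow> 'b::{comm_monoid_add, t2_space}"
  assumes "finite F" "\<And>x. f x \<noteq> 0 \<Longrightarrow> x \<in> F"
  shows "infsum f UNIV = sum f F"
proof -
  have "infsum f UNIV = infsum f F"
    by (rule infsum_cong_neutral) (use assms(2) in auto)
  then show ?thesis
    using assms(1) by simp
qed

text \<open>The substitution \<open>x = y + c\<close> lets a single finite set of offsets serve for
  every base point \<open>y\<close>.\<close>

lemma infsum_eq_sum_translate:
  fixes f :: "'a::ab_group_add \<Rightarrow> 'b::{comm_monoid_add, t2_space}"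
  assumes "finite C" "\<And>x. f x \<noteq> 0 \<Longrightarrow> x - y \<in> C"
  shows "infsum f UNIV = (\<Sum>c\<in>C. f (y + c))"
proof -
  have "infsum f UNIV = sum f ((+) y ` C)"
    using assms by (intro infsum_eq_sum) (auto intro!: image_eqI[where x = "_ - y"])
  then show ?thesis
    by (simp add: sum.reindex)
qed

lemma ctranspose_nth [simp]: "ctranspose A $ i $ j = cnj (A $ j $ i)"
  by (simp add: ctranspose_def transpose_def)

lemma ctranspose_zero [simp]: "ctranspose 0 = 0"
  by (simp add: vec_eq_iff)

lemma matrix_mult_zero [simp]:
  fixes A :: "'a::semiring_1 ^ 'n ^ 'm"
  shows "A ** (0 :: 'a ^ 'p ^ 'n) = 0"
  by (simp add: matrix_matrix_mult_def vec_eq_iff)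

lemma sum_matrix_mult:
  fixes A :: "'i \<Rightarrow> complex ^ 'n ^ 'm"
  shows "(\<Sum>i\<in>I. A i) ** B = (\<Sum>i\<in>I. A i ** B)"
  by (simp add: matrix_matrix_mult_def vec_eq_iff sum_distrib_right) (intro allI sum.swap)

lemma scaleR_matrix_mult:
  fixes A :: "complex ^ 'n ^ 'm"
  shows "(x *\<^sub>R A) ** B = x *\<^sub>R (A ** B)"
  by (simp add: matrix_matrix_mult_def vec_eq_iff scaleR_sum_right)

text \<open>The contribution of one filter pair to \<open>A(\<omega>, c)\<close>: a
  cross-correlation at offset \<open>c\<close>, with \<open>tb\<close> modulated by the frequency
  \<omega>.\<close>

definition correlation ::
  "(int ^ 'd \<Rightarrow> complex ^ 'r ^ 'p) \<Rightarrow> (int ^ 'd \<Rightarrow> complex ^ 'r ^ 'p) \<Rightarrow>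
   real ^ 'd \<Rightarrow> int ^ 'd \<Rightarrow> complex ^ 'r ^ 'r" where
  "correlation b tb \<omega> c =
     (\<chi> i j. \<Sum>p | tb p \<noteq> 0. cis (- (2 * pi * (\<omega> \<bullet> of_int_vec p)))
       * (ctranspose (b (p + c)) ** tb p) $ i $ j)"

text \<open>The common form of synthesis after analysis, with frequencies \<open>U\<close> and
  offsets \<open>C\<close>. The inner sum over frequencies is the kernel entry at position
  \<open>n\<close> and offset \<open>c\<close>.\<close>

definition fiber_op ::
  "(real ^ 'd) set \<Rightarrow> (int ^ 'd) set \<Rightarrow> (real ^ 'd \<Rightarrow> int ^ 'd \<Rightarrow> complex ^ 'r ^ 'r) \<Rightarrow>
   (int ^ 'd \<Rightarrow> complex ^ 'r ^ 't) \<Rightarrow> int ^ 'd \<Rightarrow> complex ^ 'r ^ 't" where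
  "fiber_op U C A v n =
     (\<chi> a j. \<Sum>c\<in>C. \<Sum>i\<in>UNIV. v (n + c) $ a $ i
       * (\<Sum>\<omega>\<in>U. cis (2 * pi * (\<omega> \<bullet> of_int_vec n)) * A \<omega> c $ i $ j))"

definition trig_poly ::
  "(int ^ 'd) set \<Rightarrow> (int ^ 'd \<Rightarrow> complex ^ 'q ^ 'p) \<Rightarrow> real ^ 'd \<Rightarrow> complex ^ 'q ^ 'p" where
  "trig_poly C A \<xi> = (\<chi> i j. \<Sum>c\<in>C. cis (of_int_vec c \<bullet> \<xi>) * A c $ i $ j)"

lemma symbol_nth:
  assumes "finitely_supported u"
  shows "symbol u \<xi> $ i $ j = (\<Sum>k | u k \<noteq> 0. u k $ i $ j * cis (- (of_int_vec k \<bullet> \<xi>)))"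
proof -
  have "exp (- \<i> * complex_of_real x) = cis (- x)" for x
    by (simp add: cis_conv_exp)
  then have "symbol u \<xi> $ i $ j = (\<Sum>\<^sub>\<infinity>k. u k $ i $ j * cis (- (of_int_vec k \<bullet> \<xi>)))"
    by (simp add: symbol_def)
  also have "\<dots> = (\<Sum>k | u k \<noteq> 0. u k $ i $ j * cis (- (of_int_vec k \<bullet> \<xi>)))"
    using assms by (intro infsum_eq_sum) (auto simp: finitely_supported_def)
  finally show ?thesis .
qed

text \<open>Multiplying out and collecting terms by \<open>c = q - p\<close> separates the phase
  into a factor in \<open>c\<close> and \<xi> and a factor in \<open>p\<close> and \<omega>; the
  latter is the modulation in \<open>correlation\<close>.\<close>

lemma symbol_product:
  fixes b tb :: "int ^ 'd \<Rightarrow> complex ^ 'r ^ 'p"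
  assumes "finitely_supported b" "finitely_supported tb" "finite C"
    and C: "\<And>p q. tb p \<noteq> 0 \<Longrightarrow> b q \<noteq> 0 \<Longrightarrow> q - p \<in> C"
  shows "ctranspose (symbol b \<xi>) ** symbol tb (\<xi> + (2 * pi) *\<^sub>R \<omega>)
    = trig_poly C (correlation b tb \<omega>) \<xi>"
proof -
  have "(ctranspose (symbol b \<xi>) ** symbol tb (\<xi> + (2 * pi) *\<^sub>R \<omega>)) $ i $ j
    = trig_poly C (correlation b tb \<omega>) \<xi> $ i $ j"
    for i j
  proof -
    define e where "e p = cis (- (2 * pi * (\<omega> \<bullet> of_int_vec p)))" for p
    have phase: "cis (of_int_vec (p + c) \<bullet> \<xi>) * cis (- (of_int_vec p \<bullet> (\<xi> + (2 * pi) *\<^sub>R \<omega>)))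
      = cis (of_int_vec c \<bullet> \<xi>) * e p" for p c
      by (simp add: e_def cis_mult of_int_vec_add inner_add_left inner_add_right inner_commute)
    have b_sum: "(\<Sum>q | b q \<noteq> 0. cnj (b q $ l $ i) * cis (of_int_vec q \<bullet> \<xi>))
      = (\<Sum>c\<in>C. cnj (b (p + c) $ l $ i) * cis (of_int_vec (p + c) \<bullet> \<xi>))" if "tb p \<noteq> 0" for p l
    proof -
      have "(\<Sum>q | b q \<noteq> 0. cnj (b q $ l $ i) * cis (of_int_vec q \<bullet> \<xi>))
        = (\<Sum>\<^sub>\<infinity>q. cnj (b q $ l $ i) * cis (of_int_vec q \<bullet> \<xi>))"
        using assms(1) by (intro infsum_eq_sum[symmetric]) (auto simp: finitely_supported_def)
      also have "\<dots> = (\<Sum>c\<in>C. cnj (b (p + c) $ l $ i) * cis (of_int_vec (p + c) \<bullet> \<xi>))"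
        using C[OF that] \<open>finite C\<close> by (intro infsum_eq_sum_translate) (auto, metis zero_index)
      finally show ?thesis .
    qed
    have "(ctranspose (symbol b \<xi>) ** symbol tb (\<xi> + (2 * pi) *\<^sub>R \<omega>)) $ i $ j
      = (\<Sum>l\<in>UNIV. (\<Sum>q | b q \<noteq> 0. cnj (b q $ l $ i) * cis (of_int_vec q \<bullet> \<xi>))
          * (\<Sum>p | tb p \<noteq> 0. tb p $ l $ j * cis (- (of_int_vec p \<bullet> (\<xi> + (2 * pi) *\<^sub>R \<omega>)))))"
      by (simp add: matrix_matrix_mult_def symbol_nth assms cis_cnj)
    also have "\<dots> = (\<Sum>l\<in>UNIV. \<Sum>p | tb p \<noteq> 0.
      (\<Sum>q | b q \<noteq> 0. cnj (b q $ l $ i) * cis (of_int_vec q \<bullet> \<xi>))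
          * (tb p $ l $ j * cis (- (of_int_vec p \<bullet> (\<xi> + (2 * pi) *\<^sub>R \<omega>)))))"
      by (simp only: sum_distrib_left)
    also have "\<dots> = (\<Sum>l\<in>UNIV. \<Sum>p | tb p \<noteq> 0. \<Sum>c\<in>C. cis (of_int_vec c \<bullet> \<xi>)
      * (e p * (cnj (b (p + c) $ l $ i) * tb p $ l $ j)))"
    proof (intro sum.cong refl)
      fix l p assume "p \<in> {p. tb p \<noteq> 0}"
      then have p: "tb p \<noteq> 0"
        by simp
      have "(\<Sum>q | b q \<noteq> 0. cnj (b q $ l $ i) * cis (of_int_vec q \<bullet> \<xi>))
        * (tb p $ l $ j * cis (- (of_int_vec p \<bullet> (\<xi> + (2 * pi) *\<^sub>R \<omega>))))
        = (\<Sum>c\<in>C. (cis (of_int_vec (p + c) \<bullet> \<xi>) * cis (- (of_int_vec p \<bullet> (\<xi> + (2 * pi) *\<^sub>R \<omega>))))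
          * (cnj (b (p + c) $ l $ i) * tb p $ l $ j))"
        unfolding b_sum[OF p] sum_distrib_right by (simp only: mult_ac)
      then show "(\<Sum>q | b q \<noteq> 0. cnj (b q $ l $ i) * cis (of_int_vec q \<bullet> \<xi>))
        * (tb p $ l $ j * cis (- (of_int_vec p \<bullet> (\<xi> + (2 * pi) *\<^sub>R \<omega>))))
        = (\<Sum>c\<in>C. cis (of_int_vec c \<bullet> \<xi>) * (e p * (cnj (b (p + c) $ l $ i) * tb p $ l $ j)))"
        by (simp only: phase mult.assoc)
    qed
    \<comment> \<open>Three interchanges bring \<open>c\<close> outermost and the matrix index
      \<open>l\<close> innermost, the order of summation in \<open>trig_poly\<close> and
      \<open>correlation\<close>.\<close>
    also have "\<dots> = (\<Sum>p | tb p \<noteq> 0. \<Sum>l\<in>UNIV. \<Sum>c\<in>C. cis (of_int_vec c \<bullet> \<xi>)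
      * (e p * (cnj (b (p + c) $ l $ i) * tb p $ l $ j)))"
      by (rule sum.swap)
    also have "\<dots> = (\<Sum>p | tb p \<noteq> 0. \<Sum>c\<in>C. \<Sum>l\<in>UNIV. cis (of_int_vec c \<bullet> \<xi>)
      * (e p * (cnj (b (p + c) $ l $ i) * tb p $ l $ j)))"
      by (rule sum.cong[OF refl]) (rule sum.swap)
    also have "\<dots> = (\<Sum>c\<in>C. \<Sum>p | tb p \<noteq> 0. \<Sum>l\<in>UNIV. cis (of_int_vec c \<bullet> \<xi>)
      * (e p * (cnj (b (p + c) $ l $ i) * tb p $ l $ j)))"
      by (rule sum.swap)
    also have "\<dots> = trig_poly C (correlation b tb \<omega>) \<xi> $ i $ j"
      by (simp add: trig_poly_def correlation_def e_def matrix_matrix_mult_def sum_distrib_left)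
    finally show ?thesis .
  qed
  then show ?thesis
    by (simp add: vec_eq_iff)
qed

text \<open>In the application \<open>p\<close> is a position in the support of \<open>tb\<close>,
  \<open>w\<close> a frequency, \<open>c\<close> an offset and \<open>i\<close> a matrix
  index.\<close>

lemma sum_rearrange:
  fixes X :: "_ \<Rightarrow> _ \<Rightarrow> _ \<Rightarrow> 'a::comm_semiring_0"
  shows "(\<Sum>p\<in>P. (\<Sum>w\<in>W. e w * g w p) * (\<Sum>c\<in>C. \<Sum>i\<in>I. y c i * X p c i))
    = (\<Sum>c\<in>C. \<Sum>i\<in>I. y c i * (\<Sum>w\<in>W. e w * (\<Sum>p\<in>P. g w p * X p c i)))"
proof -
  have "(\<Sum>p\<in>P. (\<Sum>w\<in>W. e w * g w p) * (\<Sum>c\<in>C. \<Sum>i\<in>I. y c i * X p c i))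
    = (\<Sum>p\<in>P. \<Sum>c\<in>C. \<Sum>i\<in>I. \<Sum>w\<in>W. e w * g w p * (y c i * X p c i))"
    by (simp only: sum_distrib_left) (simp only: sum_distrib_right)
  also have "\<dots> = (\<Sum>c\<in>C. \<Sum>p\<in>P. \<Sum>i\<in>I. \<Sum>w\<in>W. e w * g w p * (y c i * X p c i))"
    by (rule sum.swap)
  also have "\<dots> = (\<Sum>c\<in>C. \<Sum>i\<in>I. \<Sum>p\<in>P. \<Sum>w\<in>W. e w * g w p * (y c i * X p c i))"
    by (rule sum.cong[OF refl]) (rule sum.swap)
  also have "\<dots> = (\<Sum>c\<in>C. \<Sum>i\<in>I. \<Sum>w\<in>W. \<Sum>p\<in>P. e w * g w p * (y c i * X p c i))"
    by (rule sum.cong[OF refl], rule sum.cong[OF refl]) (rule sum.swap)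
  also have "\<dots> = (\<Sum>c\<in>C. \<Sum>i\<in>I. y c i * (\<Sum>w\<in>W. e w * (\<Sum>p\<in>P. g w p * X p c i)))"
    by (simp add: sum_distrib_left mult_ac)
  finally show ?thesis .
qed

text \<open>Substituting \<open>p = n - M *v k\<close> leaves a sum over those \<open>p\<close> for
  which \<open>n - p\<close> is in the image of \<open>M\<close>. The two square roots give exactly
  the factor that turns this constraint into a sum of characters.\<close>

lemma subdivision_transition:
  fixes b tb :: "int ^ 'd \<Rightarrow> complex ^ 'r ^ 'p" and v :: "int ^ 'd \<Rightarrow> complex ^ 'r ^ 't"
  assumes "finitely_supported tb" "finite C" "det M \<noteq> 0"
    and C: "\<And>p q. tb p \<noteq> 0 \<Longrightarrow> b q \<noteq> 0 \<Longrightarrow> q - p \<in> C"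
  shows "subdivision tb M (transition b M v) n = fiber_op (Omega M) C (correlation b tb) v n"
proof -
  define D :: real where "D = of_int \<bar>det M\<bar>"
  define T where "T = {p. tb p \<noteq> 0}"
  define H where "H p = (\<Sum>c\<in>C. v (n + c) ** ctranspose (b (p + c))) ** tb p" for p
  have "finite T"
    using assms(1) by (simp add: T_def finitely_supported_def)
  have inj: "inj (\<lambda>k. n - M *v k)"
    using inj_int_matrix[OF \<open>det M \<noteq> 0\<close>] by (auto simp: inj_def)
  \<comment> \<open>Writing the inner summation index as \<open>n + c\<close> makes the argument of
    \<open>b\<close> equal to \<open>p + c\<close> for \<open>p = n - M *v k\<close>.\<close>
  have summand: "transition b M v k ** tb (n - M *v k) = sqrt D *\<^sub>R H (n - M *v k)"
    if "n - M *v k \<in> T" for k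
  proof -
    have "(\<Sum>\<^sub>\<infinity>m. v m ** ctranspose (b (m - M *v k)))
      = (\<Sum>c\<in>C. v (n + c) ** ctranspose (b (n + c - M *v k)))"
    proof (rule infsum_eq_sum_translate[OF \<open>finite C\<close>])
      fix m assume "v m ** ctranspose (b (m - M *v k)) \<noteq> 0"
      then have "b (m - M *v k) \<noteq> 0"
        by auto
      then show "m - n \<in> C"
        using C[of "n - M *v k" "m - M *v k"] that by (simp add: T_def)
    qed
    moreover have "n + c - M *v k = n - M *v k + c" for c
      by simp
    ultimately show ?thesis
      by (simp add: transition_def H_def D_def scaleR_matrix_mult)
  qed
  have "(\<Sum>\<^sub>\<infinity>k. transition b M v k ** tb (n - M *v k))
    = (\<Sum>k | n - M *v k \<in> T. transition b M v k ** tb (n - M *v k))"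
    using finite_vimageI[OF \<open>finite T\<close> inj] by (intro infsum_eq_sum) (auto simp: vimage_def T_def)
  also have "\<dots> = (\<Sum>k | n - M *v k \<in> T. sqrt D *\<^sub>R H (n - M *v k))"
    using summand by (intro sum.cong) auto
  also have "\<dots> = (\<Sum>p | p \<in> T \<and> n - p \<in> range ((*v) M). sqrt D *\<^sub>R H p)"
  proof (rule sum.reindex_bij_betw)
    have "(\<lambda>k. n - M *v k) ` {k. n - M *v k \<in> T} = {p \<in> T. n - p \<in> range ((*v) M)}"
      by (auto simp: image_iff) (metis add_diff_cancel_left' diff_add_cancel)
    then show "bij_betw (\<lambda>k. n - M *v k) {k. n - M *v k \<in> T} {p. p \<in> T \<and> n - p \<in> range ((*v) M)}"
      using inj by (auto simp: bij_betw_def inj_on_def)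
  qed
  finally have "subdivision tb M (transition b M v) n
    = D *\<^sub>R (\<Sum>p | p \<in> T \<and> n - p \<in> range ((*v) M). H p)"
    by (simp add: subdivision_def flip: D_def scaleR_sum_right) (simp add: D_def)
  also have "\<dots> = (\<Sum>p\<in>T. (if n - p \<in> range ((*v) M) then D else 0) *\<^sub>R H p)"
    using \<open>finite T\<close>
    by (simp add: scaleR_sum_right sum.inter_filter[symmetric] if_distrib[of "\<lambda>x. x *\<^sub>R _"]
        cong: if_cong)
  finally have eq: "subdivision tb M (transition b M v) n = \<dots>" .
  have "subdivision tb M (transition b M v) n $ a $ j
    = fiber_op (Omega M) C (correlation b tb) v n $ a $ j" for a j
  proof -
    have H: "H p $ a $ j = (\<Sum>c\<in>C. \<Sum>i\<in>UNIV. v (n + c) $ a $ i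
      * (ctranspose (b (p + c)) ** tb p) $ i $ j)" for p
      by (simp add: H_def sum_matrix_mult flip: matrix_mul_assoc) (simp add: matrix_matrix_mult_def)
    \<comment> \<open>Orthogonality replaces the constraint, and each character of
      \<open>n - p\<close> splits into a factor in \<open>n\<close> and one in
      \<open>p\<close>.\<close>
    have phase: "of_real (if n - p \<in> range ((*v) M) then D else 0)
      = (\<Sum>\<omega>\<in>Omega M. cis (2 * pi * (\<omega> \<bullet> of_int_vec n)) * cis (- (2 * pi * (\<omega> \<bullet> of_int_vec p))))"
        for p
    proof -
      have "of_real (if n - p \<in> range ((*v) M) then D else 0)
        = (\<Sum>\<omega>\<in>Omega M. cis (2 * pi * (\<omega> \<bullet> of_int_vec (n - p))))"
        by (simp only: sum_Omega_cis[OF \<open>det M \<noteq> 0\<close>] D_def if_distrib[of of_real] of_real_of_int_eq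
          of_real_0)
      then show ?thesis
        by (simp add: cis_mult of_int_vec_diff inner_diff_right right_diff_distrib)
    qed
    have "subdivision tb M (transition b M v) n $ a $ j
      = (\<Sum>p\<in>T. of_real (if n - p \<in> range ((*v) M) then D else 0) * H p $ a $ j)"
      unfolding eq by (simp only: sum_component vector_scaleR_component)
        (simp only: scaleR_conv_of_real)
    also have "\<dots> = fiber_op (Omega M) C (correlation b tb) v n $ a $ j"
      unfolding phase H sum_rearrange by (simp add: fiber_op_def correlation_def T_def)
    finally show ?thesis .
  qed
  then show ?thesis
    by (simp add: vec_eq_iff)
qed

lemma fiber_op_add:
  "fiber_op U C (\<lambda>\<omega> c. A \<omega> c + B \<omega> c) v n = fiber_op U C A v n + fiber_op U C B v n"
  by (simp add: fiber_op_def vec_eq_iff algebra_simps sum.distrib)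

lemma fiber_op_sum: "fiber_op U C (\<lambda>\<omega> c. \<Sum>l\<in>L. A l \<omega> c) v n = (\<Sum>l\<in>L. fiber_op U C (A l) v n)"
proof (induction L rule: infinite_finite_induct)
  case (insert l L)
  then show ?case
    by (simp add: fiber_op_add)
qed (simp_all add: fiber_op_def vec_eq_iff)

text \<open>Extension by zero puts filters with different dilations over one frequency set, so that
  their operators can be added.\<close>

lemma fiber_op_restrict:
  assumes "finite U" "W \<subseteq> U"
  shows "fiber_op U C (\<lambda>\<omega> c. indicator W \<omega> *\<^sub>R A \<omega> c) v n = fiber_op W C A v n"
proof -
  have "(\<Sum>\<omega>\<in>U. f \<omega> * (indicator W \<omega> *\<^sub>R A \<omega> c) $ i $ j) = (\<Sum>\<omega>\<in>W. f \<omega> * A \<omega> c $ i $ j)" for f c i j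
    using assms by (intro sum.mono_neutral_cong_right) auto
  then show ?thesis
    by (simp add: fiber_op_def)
qed

lemma trig_poly_add: "trig_poly C (\<lambda>c. A c + B c) \<xi> = trig_poly C A \<xi> + trig_poly C B \<xi>"
  by (simp add: trig_poly_def vec_eq_iff algebra_simps sum.distrib)

lemma trig_poly_scaleR: "trig_poly C (\<lambda>c. x *\<^sub>R A c) \<xi> = x *\<^sub>R trig_poly C A \<xi>"
  by (simp add: trig_poly_def vec_eq_iff scaleR_sum_right)

lemma trig_poly_sum: "trig_poly C (\<lambda>c. \<Sum>l\<in>L. A l c) \<xi> = (\<Sum>l\<in>L. trig_poly C (A l) \<xi>)"
proof (induction L rule: infinite_finite_induct)
  case (insert l L)
  then show ?case
    by (simp add: trig_poly_add)
qed (simp_all add: trig_poly_def vec_eq_iff)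

section \<open>Uniqueness of coefficients\<close>

lemma fiber_op_delta:
  assumes "finite U" "finite C" "0 \<in> U" "0 \<in> C"
    and A: "\<And>\<omega> c. \<omega> \<in> U \<Longrightarrow> c \<in> C \<Longrightarrow> A \<omega> c = (if \<omega> = 0 \<and> c = 0 then mat 1 else 0)"
  shows "fiber_op U C A v = v"
proof -
  have inner: "(\<Sum>\<omega>\<in>U. cis (2 * pi * (\<omega> \<bullet> of_int_vec n)) * A \<omega> c $ i $ j)
    = (if c = 0 then if i = j then 1 else 0 else 0)"
    if "c \<in> C" for n c i j
  proof -
    have "(\<Sum>\<omega>\<in>U. cis (2 * pi * (\<omega> \<bullet> of_int_vec n)) * A \<omega> c $ i $ j)
      = (\<Sum>\<omega>\<in>U. if \<omega> = 0 then if c = 0 then if i = j then 1 else 0 else 0 else 0)"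
      using that by (intro sum.cong) (auto simp: A mat_def)
    then show ?thesis
      using assms by simp
  qed
  have "fiber_op U C A v n $ a $ j = v n $ a $ j" for n a j
  proof -
    have "fiber_op U C A v n $ a $ j = (\<Sum>c\<in>C. if c = 0 then v n $ a $ j else 0)"
      unfolding fiber_op_def
      by (auto simp: inner if_distrib[of "\<lambda>x. _ * x"] cong: if_cong intro!: sum.cong)
    then show ?thesis
      using assms by simp
  qed
  then show ?thesis
    by (simp add: fun_eq_iff vec_eq_iff)
qed

text \<open>Unit sequences read off the kernel entry by entry. For fixed \<open>c\<close> the kernel
  is constant in \<open>n\<close>, so independence of characters leaves only the frequency
  0.\<close>

lemma fiber_op_eq_idD:
  fixes A :: "real ^ 'd \<Rightarrow> int ^ 'd \<Rightarrow> complex ^ 'r ^ 'r"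
  assumes "finite U" "U \<subseteq> unit_cube" "0 \<in> U" "finite C"
    and id: "\<And>v :: int ^ 'd \<Rightarrow> complex ^ 'r ^ 't. finitely_supported v \<Longrightarrow> fiber_op U C A v = v"
    and "\<omega> \<in> U" "c \<in> C"
  shows "A \<omega> c = (if \<omega> = 0 \<and> c = 0 then mat 1 else 0)"
proof -
  have "A \<omega> c $ i $ j = (if \<omega> = 0 \<and> c = 0 then mat 1 else 0) $ i $ j" for i j
  proof -
    define \<delta> :: complex where "\<delta> = (if c = 0 \<and> i = j then 1 else 0)"
    have kernel: "(\<Sum>\<omega>\<in>U. cis (2 * pi * (\<omega> \<bullet> of_int_vec n)) * A \<omega> c $ i $ j) = \<delta>" for n
    proof -
      \<comment> \<open>Supported at \<open>n + c\<close> and with every row the unit vector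
        \<open>i\<close>, this sequence isolates the kernel entries of row \<open>i\<close> and
        offset \<open>c\<close> at position \<open>n\<close>.\<close>
      define v :: "int ^ 'd \<Rightarrow> complex ^ 'r ^ 't" where
        "v = (\<lambda>m. if m = n + c then (\<chi> a. axis i 1) else 0)"
      have "{m. v m \<noteq> 0} \<subseteq> {n + c}"
        by (auto simp: v_def)
      then have "finitely_supported v"
        unfolding finitely_supported_def by (rule finite_subset) simp
      then have "fiber_op U C A v n $ a $ j = v n $ a $ j" for a
        by (simp add: id)
      moreover have "v n $ a $ j = \<delta>" for a
        by (auto simp: v_def \<delta>_def axis_def)
      moreover have "fiber_op U C A v n $ a $ j
        = (\<Sum>\<omega>\<in>U. cis (2 * pi * (\<omega> \<bullet> of_int_vec n)) * A \<omega> c $ i $ j)" (is "_ = ?S c i") for a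
      proof -
        have "fiber_op U C A v n $ a $ j
          = (\<Sum>c'\<in>C. \<Sum>i'\<in>UNIV. if c' = c then if i' = i then ?S c i else 0 else 0)"
          unfolding fiber_op_def vec_lambda_beta
          by (intro sum.cong refl) (auto simp: v_def axis_def)
        also have "\<dots> = (\<Sum>c'\<in>C. if c' = c then ?S c i else 0)"
          by (intro sum.cong refl) simp
        finally show ?thesis
          using \<open>finite C\<close> \<open>c \<in> C\<close> by simp
      qed
      ultimately show ?thesis
        by simp
    qed
    \<comment> \<open>The constant \<delta> is a multiple of the trivial character; moving it into
      the coefficient at \<omega> = 0 gives a vanishing combination.\<close>
    have "A \<omega> c $ i $ j - (if \<omega> = 0 then \<delta> else 0) = 0"
    proof (rule independent_characters[where I = U and i = \<omega>
          and f = "\<lambda>\<omega> n. cis (2 * pi * (\<omega> \<bullet> of_int_vec n))"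
          and c = "\<lambda>\<omega>. A \<omega> c $ i $ j - (if \<omega> = 0 then \<delta> else 0)"])
      fix n :: "int ^ 'd"
      have "(\<Sum>\<omega>\<in>U. (A \<omega> c $ i $ j - (if \<omega> = 0 then \<delta> else 0)) * cis (2 * pi * (\<omega> \<bullet> of_int_vec n)))
        = (\<Sum>\<omega>\<in>U. cis (2 * pi * (\<omega> \<bullet> of_int_vec n)) * A \<omega> c $ i $ j) -
          (\<Sum>\<omega>\<in>U. if \<omega> = 0 then \<delta> else 0)"
        unfolding sum_subtractf[symmetric] by (intro sum.cong refl) (simp add: algebra_simps)
      then show "(\<Sum>\<omega>\<in>U. (A \<omega> c $ i $ j - (if \<omega> = 0 then \<delta> else 0))
        * cis (2 * pi * (\<omega> \<bullet> of_int_vec n))) = 0"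
        using assms by (simp add: kernel)
    next
      show "inj_on (\<lambda>\<omega> n. cis (2 * pi * (\<omega> \<bullet> of_int_vec n))) U"
        using inj_on_cis_of_int_vec \<open>U \<subseteq> unit_cube\<close> by (rule inj_on_subset)
    qed (use assms in \<open>simp_all add: of_int_vec_add inner_add_right distrib_left cis_mult\<close>)
    then show ?thesis
      by (auto simp: \<delta>_def mat_def)
  qed
  then show ?thesis
    by (simp add: vec_eq_iff)
qed

lemma trig_poly_delta:
  assumes "finite C" "0 \<in> C" "\<And>c. c \<in> C \<Longrightarrow> A c = (if c = 0 then B else 0)"
  shows "trig_poly C A \<xi> = B"
proof -
  have "trig_poly C A \<xi> $ i $ j = B $ i $ j" for i j
  proof -
    have "trig_poly C A \<xi> $ i $ j = (\<Sum>c\<in>C. if c = 0 then B $ i $ j else 0)"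
      unfolding trig_poly_def vec_lambda_beta by (intro sum.cong refl) (simp add: assms(3))
    then show ?thesis
      using assms(1,2) by simp
  qed
  then show ?thesis
    by (simp add: vec_eq_iff)
qed

lemma continuous_on_trig_poly: "continuous_on S (trig_poly C A)"
  unfolding trig_poly_def cis_conv_exp by (intro continuous_intros)

text \<open>The set where two continuous functions differ is open, and a negligible open set is
  empty.\<close>

lemma AE_lebesgue_eq_imp_eq:
  fixes f g :: "'a::euclidean_space \<Rightarrow> 'b::t2_space"
  assumes "AE x in lebesgue. f x = g x" "continuous_on UNIV f" "continuous_on UNIV g"
  shows "f x = g x"
proof -
  obtain N where N: "{x \<in> space lebesgue. f x \<noteq> g x} \<subseteq> N" "N \<in> null_sets lebesgue"
    using assms(1) unfolding eventually_ae_filter by blast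
  then have "negligible N"
    by (simp add: negligible_iff_null_sets)
  then have "negligible {x. f x \<noteq> g x}"
    by (rule negligible_subset) (use N(1) in simp)
  moreover have "open {x. f x \<noteq> g x}"
    using assms(2,3) by (rule open_Collect_neq)
  ultimately have "{x. f x \<noteq> g x} = {}"
    by (metis open_not_negligible)
  then show ?thesis
    by blast
qed

text \<open>Continuity upgrades the identity to all points. The constant \<open>B\<close> is then
  absorbed into the coefficient of the trivial character \<open>c = 0\<close>, and independence
  applies.\<close>

lemma trig_poly_AE_eqD:
  assumes "finite C" "0 \<in> C" "AE \<xi> in lebesgue. trig_poly C A \<xi> = B" "c \<in> C"
  shows "A c = (if c = 0 then B else 0)"
proof -
  have eq: "trig_poly C A \<xi> = B" for \<xi>
    using AE_lebesgue_eq_imp_eq[OF assms(3)] continuous_on_trig_poly continuous_on_const by blast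
  have "A c $ i $ j = (if c = 0 then B else 0) $ i $ j" for i j
  proof -
    have "A c $ i $ j - (if c = 0 then B $ i $ j else 0) = 0"
    proof (rule independent_characters[where I = C and i = c and f = "\<lambda>c \<xi>. cis (of_int_vec c \<bullet> \<xi>)"
          and c = "\<lambda>c. A c $ i $ j - (if c = 0 then B $ i $ j else 0)"])
      fix \<xi> :: "real ^ 'a"
      have "(\<Sum>c\<in>C. (A c $ i $ j - (if c = 0 then B $ i $ j else 0)) * cis (of_int_vec c \<bullet> \<xi>))
        = (\<Sum>c\<in>C. cis (of_int_vec c \<bullet> \<xi>) * A c $ i $ j) - (\<Sum>c\<in>C. if c = 0 then B $ i $ j else 0)"
        by (simp add: algebra_simps if_distrib[of "\<lambda>x. _ * x"] sum_subtractf cong: if_cong)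
      also have "\<dots> = trig_poly C A \<xi> $ i $ j - B $ i $ j"
        using assms(1,2) by (simp add: trig_poly_def)
      finally show "(\<Sum>c\<in>C. (A c $ i $ j - (if c = 0 then B $ i $ j else 0))
        * cis (of_int_vec c \<bullet> \<xi>)) = 0"
        by (simp add: eq)
    next
      show "inj_on (\<lambda>c \<xi>. cis (of_int_vec c \<bullet> \<xi>)) C"
        using inj_cis_inner by (rule inj_on_subset) simp
    qed (use assms(1,4) in \<open>simp_all add: inner_add_right cis_mult\<close>)
    then show ?thesis
      by simp
  qed
  then show ?thesis
    by (simp add: vec_eq_iff)
qed

section \<open>Passage between one level and many levels\<close>

lemma reconstruct_decomp:
  assumes "\<And>v. synthesis_op s tb0 tb M (analysis_op s b0 b M v) = v"
  shows "reconstruct s tb0 tb M (decomp_high b0 b M v) J (decomp_low b0 M v J) = v"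
proof (induction J)
  case (Suc J)
  \<comment> \<open>High-pass data at level \<open>Suc J\<close> come from the low-pass data at
    level \<open>J\<close>, so the first synthesis step undoes the last analysis step.\<close>
  have "synthesis_op s tb0 tb M (\<lambda>l. decomp_high b0 b M v l (Suc J), decomp_low b0 M v (Suc J))
    = synthesis_op s tb0 tb M (analysis_op s b0 b M (decomp_low b0 M v J))"
    by (simp add: analysis_op_def decomp_high_def)
  also have "\<dots> = decomp_low b0 M v J"
    by (rule assms)
  finally show ?case
    using Suc by (simp only: reconstruct.simps)
qed simp

lemma perfect_reconstruction_1:
  "perfect_reconstruction s b0 b tb0 tb M 1
    \<longleftrightarrow> (\<forall>v. synthesis_op s tb0 tb M (analysis_op s b0 b M v) = v)"
  by (simp add: perfect_reconstruction_def analysis_op_def decomp_high_def)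

theorem theorem2p3:
  fixes s :: nat
    and b0 tb0 :: "int ^ 'd \<Rightarrow> complex ^ 'r ^ 'r"
    and b tb :: "nat \<Rightarrow> int ^ 'd \<Rightarrow> complex ^ 'r ^ 1"
    and M :: "nat \<Rightarrow> int ^ 'd ^ 'd"
  assumes "s \<ge> 1"
    and "finitely_supported b0" and "finitely_supported tb0"
    and "\<And>l. l \<in> {1..s} \<Longrightarrow> finitely_supported (b l)"
    and "\<And>l. l \<in> {1..s} \<Longrightarrow> finitely_supported (tb l)"
    and "\<And>l. l \<in> {0..s} \<Longrightarrow> dilation_matrix (M l)"
  shows "((\<forall>J\<ge>1. perfect_reconstruction s b0 b tb0 tb M J) \<longleftrightarrow>
          (\<forall>v. finitely_supported v \<longrightarrow> synthesis_op s tb0 tb M (analysis_op s b0 b M v) = v)) \<and>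
         ((\<forall>v. finitely_supported v \<longrightarrow> synthesis_op s tb0 tb M (analysis_op s b0 b M v) = v) \<longleftrightarrow>
          dual_framelet_filter_bank s b0 b tb0 tb M)"
proof -
  have det: "det (M l) \<noteq> 0" if "l \<in> {0..s}" for l
    using assms(6)[OF that] by (rule dilation_matrix_det_nonzero)
  define U where "U = (\<Union>l\<in>{0..s}. Omega (M l))"
  have Omega_U: "Omega (M l) \<subseteq> U" if "l \<in> {0..s}" for l
    using that by (auto simp: U_def)
  have "finite U"
    unfolding U_def by (intro finite_UN_I finite_Omega det) auto
  moreover have "U \<subseteq> unit_cube"
    unfolding U_def by (intro UN_least Omega_subset_unit_cube)
  moreover have "0 \<in> U"
    using Omega_U[of 0] zero_in_Omega[of "M 0"] by auto
  ultimately have U: "finite U" "U \<subseteq> unit_cube" "0 \<in> U" .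
  \<comment> \<open>All differences of support points that can contribute, for all filters at once.
    The offset 0 is added because it must carry the identity matrix.\<close>
  define C where "C = insert 0 ((\<lambda>(p, q). q - p) ` ({p. tb0 p \<noteq> 0} \<times> {q. b0 q \<noteq> 0})
    \<union> (\<Union>l\<in>{1..s}. (\<lambda>(p, q). q - p) ` ({p. tb l p \<noteq> 0} \<times> {q. b l q \<noteq> 0})))"
  have C: "finite C" "0 \<in> C"
    using assms by (auto simp: C_def finitely_supported_def)
  have C0: "q - p \<in> C" if "tb0 p \<noteq> 0" "b0 q \<noteq> 0" for p q
    using that by (auto simp: C_def)
  have Cl: "q - p \<in> C" if "l \<in> {1..s}" "tb l p \<noteq> 0" "b l q \<noteq> 0" for l p q
    using that unfolding C_def by (intro insertI2 UnI2 UN_I[of l] image_eqI[of _ _ "(p, q)"]) auto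
  \<comment> \<open>This is \<open>A(\<omega>, c)\<close>; the indicator functions confine each
    filter to its own frequencies.\<close>
  define G where "G \<omega> c = indicator (Omega (M 0)) \<omega> *\<^sub>R correlation b0 tb0 \<omega> c
    + (\<Sum>l = 1..s. indicator (Omega (M l)) \<omega> *\<^sub>R correlation (b l) (tb l) \<omega> c)" for \<omega> c

  \<comment> \<open>The formula holds for every sequence \<open>v\<close>. Thus coefficients
    determined by finitely supported inputs give the identity on all inputs.\<close>
  have synthesis_analysis: "synthesis_op s tb0 tb M (analysis_op s b0 b M v) = fiber_op U C G v"
    for v
  proof
    fix n
    have "subdivision (tb l) (M l) (transition (b l) (M l) v) n
      = fiber_op U C (\<lambda>\<omega> c. indicator (Omega (M l)) \<omega> *\<^sub>R correlation (b l) (tb l) \<omega> c) v n"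
        if "l \<in> {1..s}" for l
      using that assms(5) C(1) det Cl Omega_U U(1)
      by (subst subdivision_transition) (auto simp: fiber_op_restrict)
    moreover have "subdivision tb0 (M 0) (transition b0 (M 0) v) n
      = fiber_op U C (\<lambda>\<omega> c. indicator (Omega (M 0)) \<omega> *\<^sub>R correlation b0 tb0 \<omega> c) v n"
      using assms(3) C(1) det C0 Omega_U U(1)
      by (subst subdivision_transition) (auto simp: fiber_op_restrict)
    ultimately show "synthesis_op s tb0 tb M (analysis_op s b0 b M v) n = fiber_op U C G v n"
      unfolding G_def[abs_def] fiber_op_add fiber_op_sum by (simp add: analysis_op_def)
  qed
  have "indicator (Omega (M 0)) \<omega> *\<^sub>R (ctranspose (symbol b0 \<xi>) ** symbol tb0 (\<xi> + (2 * pi) *\<^sub>R \<omega>))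
      + (\<Sum>l = 1..s. indicator (Omega (M l)) \<omega> *\<^sub>R
        (ctranspose (symbol (b l) \<xi>) ** symbol (tb l) (\<xi> + (2 * pi) *\<^sub>R \<omega>)))
    = trig_poly C (G \<omega>) \<xi>" for \<omega> \<xi>
  proof -
    have "ctranspose (symbol (b l) \<xi>) ** symbol (tb l) (\<xi> + (2 * pi) *\<^sub>R \<omega>)
      = trig_poly C (correlation (b l) (tb l) \<omega>) \<xi>"
      if "l \<in> {1..s}" for l
      using that assms(4,5) C(1) Cl by (intro symbol_product) auto
    moreover have "ctranspose (symbol b0 \<xi>) ** symbol tb0 (\<xi> + (2 * pi) *\<^sub>R \<omega>)
      = trig_poly C (correlation b0 tb0 \<omega>) \<xi>"
      using assms(2,3) C(1) C0 by (intro symbol_product) auto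
    ultimately show ?thesis
      by (simp add: G_def[abs_def] trig_poly_add trig_poly_sum trig_poly_scaleR)
  qed
  then have dual: "dual_framelet_filter_bank s b0 b tb0 tb M
    \<longleftrightarrow> (AE \<xi> in lebesgue. \<forall>\<omega>\<in>U. trig_poly C (G \<omega>) \<xi> = (if \<omega> = 0 then mat 1 else 0))"
    by (simp add: dual_framelet_filter_bank_def U_def)

  \<comment> \<open>All three statements are compared with this condition on the
    coefficients.\<close>
  let ?G_delta = "\<forall>\<omega>\<in>U. \<forall>c\<in>C. G \<omega> c = (if \<omega> = 0 \<and> c = 0 then mat 1 else 0)"
  have G_delta_imp: "synthesis_op s tb0 tb M (analysis_op s b0 b M v) = v" if ?G_delta for v
    unfolding synthesis_analysis using U C that by (intro fiber_op_delta) auto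
  have imp_G_delta: ?G_delta
    if "\<And>v. finitely_supported v \<Longrightarrow> synthesis_op s tb0 tb M (analysis_op s b0 b M v) = v"
    using that unfolding synthesis_analysis by (intro ballI fiber_op_eq_idD[OF U C(1)]) auto
  have "dual_framelet_filter_bank s b0 b tb0 tb M" if ?G_delta
    unfolding dual
  proof (intro AE_I2 ballI)
    fix \<xi> \<omega> assume "\<omega> \<in> U"
    then show "trig_poly C (G \<omega>) \<xi> = (if \<omega> = 0 then mat 1 else 0)"
      using that C by (intro trig_poly_delta) auto
  qed
  moreover have ?G_delta if "dual_framelet_filter_bank s b0 b tb0 tb M"
  proof (intro ballI)
    fix \<omega> c assume "\<omega> \<in> U" "c \<in> C"
    \<comment> \<open>Fixing one frequency inside the almost-everywhere statement gives a single
      trigonometric identity, to which uniqueness of coefficients applies.\<close>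
    have "AE \<xi> in lebesgue. trig_poly C (G \<omega>) \<xi> = (if \<omega> = 0 then mat 1 else 0)"
      using that \<open>\<omega> \<in> U\<close> unfolding dual by (auto elim: eventually_mono)
    from trig_poly_AE_eqD[OF C this \<open>c \<in> C\<close>]
    show "G \<omega> c = (if \<omega> = 0 \<and> c = 0 then mat 1 else 0)"
      by simp
  qed
  moreover have "perfect_reconstruction s b0 b tb0 tb M J" if ?G_delta for J
    unfolding perfect_reconstruction_def using reconstruct_decomp[OF G_delta_imp[OF that]] by blast
  \<comment> \<open>The case \<open>J = 1\<close> of perfect reconstruction is synthesis after
    analysis, on all sequences.\<close>
  moreover have "synthesis_op s tb0 tb M (analysis_op s b0 b M v) = v"
    if "\<forall>J\<ge>1. perfect_reconstruction s b0 b tb0 tb M J" for v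
    using that perfect_reconstruction_1 by blast
  ultimately show ?thesis
    using G_delta_imp imp_G_delta by blast
qed

end
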